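(* Let $d\geq3$ and let $n=dm$ for some integer $m\geq2$. Then there exists a constant $C>0$, independent of $n$ and $d$, such that $\gamma_{\mathrm{SL}(n)}(\varrho_{n,d})\leq 2^{-Cdm}=2^{-Cn}$. More concretely, for $d=3$ and $m\geq3$, $$\gamma_{\mathrm{SL}(n)}(\varrho_{n,d})\leq\operatorname{dist}(0,\operatorname{conv}(\Gamma_{m,3}))\leq 2^{-m+1}=2^{-\frac n3+1},$$ and if $m\geq3$ and $d=6r-3$ for some $r\geq2$, $$\gamma_{\mathrm{SL}(n)}(\varrho_{n,d})\leq\operatorname{dist}(0,\operatorname{conv}(\Gamma_{m,6r-3}))\leq 2^{-r(m-1)+1}=2^{-\frac{(d+3)(m-1)}{6}+1}.$$
   Context: $\varrho_{n,d}:\mathrm{SL}(n)\to\mathrm{GL}(\mathbb{C}[x_1,\dots,x_n]_d)$ is the representation on homogeneous degree-$d$ polynomials given by $(g\cdot p)(x)=p(g^{-1}x)$. Fix an $\mathrm{SU}(n)$-invariant Hermitian inner product $\langle\cdot,\cdot\rangle$ on $V=\mathbb{C}[x_1,\dots,x_n]_d$ and let $\Pi$ be the induced Lie algebra representation $\Pi(A)=\frac{d}{dt}|_{t=0}\varrho_{n,d}(e^{tA})$. For $v\neq0$, the moment map $\mu(v)$ is the unique traceless Hermitian $n\times n$ matrix with $\operatorname{tr}(\mu(v)A)=\langle v,\Pi(A)v\rangle/\langle v,v\rangle$ for all traceless Hermitian $A$. $v$ is unstable if $0\in\overline{\mathrm{SL}(n)\cdot v}$. The gap is $\gamma_{\mathrm{SL}(n)}(\varrho_{n,d}):=\min\{\|\mu(v)\|_F: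 v\neq0\text{ unstable}\}$. For the concrete bounds: let $\varepsilon_i:=e_i-\frac1m\mathbb{1}_m\in\mathbb{R}^m$. For $N\geq2$ let $\mathfrak{W}_N:=\bigcup_{s=2}^N\{(s,1,s),(s,s,1),(s-1,s,s)\}\subseteq[N]^3$. Let $\Gamma_{m,3}:=\{(\varepsilon_i,\varepsilon_j,\varepsilon_k):(i,j,k)\in\mathfrak{W}_m\}\subseteq(\mathbb{R}^m)^3$. For $r\geq2$: let $\mathrm{mod}'\,m$ denote reduction modulo $m$ with values in $[m]$ (outputting $m$ instead of $0$); for $i\in[r]$ define $\sigma_i:[rm]\to[m]$, $j\mapsto\lceil (j+i-1)/r\rceil\ \mathrm{mod}'\,m$, and for $i\in[r-1]$ define $\sigma_{r+i}:=\sigma_1\circ\tau_i$, where $\tau_i$ is the transposition of $r-i+1$ and $r+1$ in the symmetric group on $[rm]$. Write $\varepsilon_{\sigma(j)}:=(\varepsilon_{\sigma_1(j)},\dots,\varepsilon_{\sigma_{2r-1}(j)})\in(\mathbb{R}^m)^{2r-1}$, let $\mathfrak{J}_r:=\{(s,1,s),(s,s,1): s=2,\dots,r\}$, and $\Gamma_{m,6r-3}:=\{(\varepsilon_{\sigma(i)},\varepsilon_{\sigma(j)},\varepsilon_{\sigma(k)}):(i,j,k)\in\mathfrak{W}_{rm}\setminus\mathfrak{J}_r\}\subseteq(\mathbb{R}^m)^{6r-3}$. *)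

theory Defs
  imports
    "HOL-Analysis.Finite_Function_Topology"
    "HOL-Analysis.Derivative"
    "HOL-Analysis.L2_Norm"
    "HOL-Combinatorics.Transposition"
    "Jordan_Normal_Form.Gauss_Jordan_Elimination"
    "Jordan_Normal_Form.Schur_Decomposition"
begin

subsection \<open>The action of the special linear group on forms\<close>

text \<open>
  Polynomials are finitely supported maps from exponent vectors to coefficients; the product is
  the convolution product of \<^theory>\<open>HOL-Library.Poly_Mapping\<close>. Variables are numbered
  \<open>0, \<dots>, n - 1\<close> like the rows and columns of a matrix. The topology is the one of
  \<^theory>\<open>HOL-Analysis.Finite_Function_Topology\<close>, coming from the sum of the absolute values of the
  coefficients; on the finite-dimensional spaces of forms it is the Euclidean topology.
\<close>

type_synonym mpoly = "(nat \<Rightarrow>\<^sub>0 nat) \<Rightarrow>\<^sub>0 complex"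

definition forms :: "nat \<Rightarrow> nat \<Rightarrow> mpoly set" where
  "forms n d = {p. \<forall>a\<in>Poly_Mapping.keys p.
     Poly_Mapping.keys a \<subseteq> {..<n} \<and> (\<Sum>i<n. Poly_Mapping.lookup a i) = d}"

definition const_mpoly :: "complex \<Rightarrow> mpoly" where
  "const_mpoly c = Poly_Mapping.single 0 c"

definition var_mpoly :: "nat \<Rightarrow> mpoly" where
  "var_mpoly i = Poly_Mapping.single (Poly_Mapping.single i 1) 1"

definition subst_mpoly :: "(nat \<Rightarrow> mpoly) \<Rightarrow> mpoly \<Rightarrow> mpoly" where
  "subst_mpoly f p = (\<Sum>a\<in>Poly_Mapping.keys p.
     const_mpoly (Poly_Mapping.lookup p a) *
     (\<Prod>i\<in>Poly_Mapping.keys a. f i ^ Poly_Mapping.lookup a i))"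

definition SL :: "nat \<Rightarrow> complex mat set" where
  "SL n = {g \<in> carrier_mat n n. Determinant.det g = 1}"

definition SU :: "nat \<Rightarrow> complex mat set" where
  "SU n = {g \<in> SL n. g * mat_adjoint g = 1\<^sub>m n}"

text \<open>\<open>(g \<cdot> p)(x) = p(g\<^sup>-\<^sup>1 x)\<close>: the \<open>i\<close>-th variable is replaced by the
  \<open>i\<close>-th coordinate of \<open>g\<^sup>-\<^sup>1 x\<close>.\<close>

definition rep :: "complex mat \<Rightarrow> mpoly \<Rightarrow> mpoly" where
  "rep g = subst_mpoly (\<lambda>i. \<Sum>j<dim_row g. const_mpoly (the (mat_inverse g) $$ (i, j)) * var_mpoly j)"

definition mat_exp :: "complex mat \<Rightarrow> complex mat" where
  "mat_exp A = mat (dim_row A) (dim_row A) (\<lambda>(i, j). suminf (\<lambda>k. (A ^\<^sub>m k) $$ (i, j) / fact k))"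

definition lie_rep :: "complex mat \<Rightarrow> mpoly \<Rightarrow> mpoly" where
  "lie_rep A p = vector_derivative (\<lambda>t. rep (mat_exp (complex_of_real t \<cdot>\<^sub>m A)) p) (at 0)"


subsection \<open>Moment map and gap\<close>

text \<open>Inner products are antilinear in the first argument; only the values on
  \<^term>\<open>forms n d\<close> matter.\<close>

definition SU_invariant_inner :: "nat \<Rightarrow> nat \<Rightarrow> (mpoly \<Rightarrow> mpoly \<Rightarrow> complex) \<Rightarrow> bool" where
  "SU_invariant_inner n d ip \<longleftrightarrow>
     (\<forall>p\<in>forms n d. \<forall>q\<in>forms n d. ip q p = cnj (ip p q)) \<and>
     (\<forall>p\<in>forms n d. \<forall>q\<in>forms n d. \<forall>r\<in>forms n d. ip p (q + r) = ip p q + ip p r) \<and>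
     (\<forall>p\<in>forms n d. \<forall>q\<in>forms n d. \<forall>c. ip p (const_mpoly c * q) = c * ip p q) \<and>
     (\<forall>p\<in>forms n d. p \<noteq> 0 \<longrightarrow> Re (ip p p) > 0) \<and>
     (\<forall>g\<in>SU n. \<forall>p\<in>forms n d. \<forall>q\<in>forms n d. ip (rep g p) (rep g q) = ip p q)"

definition mat_trace :: "complex mat \<Rightarrow> complex" where
  "mat_trace A = (\<Sum>i<dim_row A. A $$ (i, i))"

definition frobenius_norm :: "complex mat \<Rightarrow> real" where
  "frobenius_norm A = sqrt (\<Sum>i<dim_row A. \<Sum>j<dim_col A. (cmod (A $$ (i, j)))\<^sup>2)"

definition traceless_hermitian :: "nat \<Rightarrow> complex mat set" where
  "traceless_hermitian n = {A \<in> carrier_mat n n. mat_adjoint A = A \<and> mat_trace A = 0}"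

definition moment_map :: "nat \<Rightarrow> (mpoly \<Rightarrow> mpoly \<Rightarrow> complex) \<Rightarrow> mpoly \<Rightarrow> complex mat" where
  "moment_map n ip v = (THE H. H \<in> traceless_hermitian n \<and>
     (\<forall>A\<in>traceless_hermitian n. mat_trace (H * A) = ip v (lie_rep A v) / ip v v))"

definition unstable :: "nat \<Rightarrow> mpoly \<Rightarrow> bool" where
  "unstable n v \<longleftrightarrow> 0 \<in> closure ((\<lambda>g. rep g v) ` SL n)"

text \<open>The infimum is attained, because the unstable vectors form a closed cone and the moment map
  is continuous and invariant under scaling; so this is the minimum.\<close>

definition gap :: "nat \<Rightarrow> nat \<Rightarrow> (mpoly \<Rightarrow> mpoly \<Rightarrow> complex) \<Rightarrow> real" where
  "gap n d ip = Inf {frobenius_norm (moment_map n ip v) | v. v \<in> forms n d \<and> v \<noteq> 0 \<and> unstable n v}"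


subsection \<open>The weight sets\<close>

text \<open>
  An element of \<open>(\<real>\<^sup>m)\<^sup>d\<close> is a finitely supported map whose argument \<open>(b, k)\<close>, with \<open>b < d\<close> and
  \<open>k \<in> {1..m}\<close>, stands for the \<open>k\<close>-th coordinate in the block number \<open>b\<close>. The library norm on this
  type is the sum of the absolute values, hence the Euclidean distance is spelled out below.
\<close>

type_synonym blockvec = "(nat \<times> nat) \<Rightarrow>\<^sub>0 real"

definition eps :: "nat \<Rightarrow> nat \<Rightarrow> nat \<Rightarrow> blockvec" where
  "eps m b i = Poly_Mapping.single (b, i) 1 - (\<Sum>k=1..m. Poly_Mapping.single (b, k) (1 / real m))"

definition eps_tuple :: "nat \<Rightarrow> nat list \<Rightarrow> blockvec" where
  "eps_tuple m is = (\<Sum>b<length is. eps m b (is ! b))"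

definition euclid_dist_0 :: "blockvec set \<Rightarrow> real" where
  "euclid_dist_0 S = (INF x\<in>S. L2_set (Poly_Mapping.lookup x) (Poly_Mapping.keys x))"

definition W_set :: "nat \<Rightarrow> (nat \<times> nat \<times> nat) set" where
  "W_set N = (\<Union>s\<in>{2..N}. {(s, 1, s), (s, s, 1), (s - 1, s, s)})"

definition J_set :: "nat \<Rightarrow> (nat \<times> nat \<times> nat) set" where
  "J_set r = (\<Union>s\<in>{2..r}. {(s, 1, s), (s, s, 1)})"

definition mod' :: "nat \<Rightarrow> nat \<Rightarrow> nat" where
  "mod' x m = (if x mod m = 0 then m else x mod m)"

definition sigma_low :: "nat \<Rightarrow> nat \<Rightarrow> nat \<Rightarrow> nat \<Rightarrow> nat" where
  "sigma_low r m i j = mod' (nat \<lceil>(real j + real i - 1) / real r\<rceil>) m"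

text \<open>For \<open>l = r + i\<close> with \<open>1 \<le> i \<le> r - 1\<close> the transposition swaps \<open>r - i + 1\<close> and \<open>r + 1\<close>.\<close>

definition sigma :: "nat \<Rightarrow> nat \<Rightarrow> nat \<Rightarrow> nat \<Rightarrow> nat" where
  "sigma r m l = (if l \<le> r then sigma_low r m l
     else sigma_low r m 1 \<circ> Transposition.transpose (r - (l - r) + 1) (r + 1))"

definition sigma_list :: "nat \<Rightarrow> nat \<Rightarrow> nat \<Rightarrow> nat list" where
  "sigma_list r m j = map (\<lambda>l. sigma r m l j) [1..<2 * r]"

definition Gamma3 :: "nat \<Rightarrow> blockvec set" where
  "Gamma3 m = {eps_tuple m [i, j, k] | i j k. (i, j, k) \<in> W_set m}"

definition Gamma_odd :: "nat \<Rightarrow> nat \<Rightarrow> blockvec set" where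
  "Gamma_odd m r = {eps_tuple m (sigma_list r m i @ sigma_list r m j @ sigma_list r m k) | i j k.
     (i, j, k) \<in> W_set (r * m) - J_set r}"

end

theory Submission
  imports Defs "Jordan_Normal_Form.Jordan_Normal_Form"
begin

text \<open>
  A form supported on a free set of monomials (no two exponents differ by a root \<open>e\<^sub>i - e\<^sub>j\<close>) has a
  diagonal moment map: torus invariance makes distinct monomials orthogonal, so only the diagonal of
  the Lie algebra contributes. The diagonal is minus the convex combination of the weights with
  coefficients \<open>|c\<^sub>a|\<^sup>2 \<parallel>x\<^sup>a\<parallel>\<^sup>2\<close>, and every convex combination arises. If moreover some traceless
  diagonal matrix pairs positively with all the weights, its one-parameter group scales the form to
  \<open>0\<close>, so the form is unstable and the gap is bounded by the distance of \<open>0\<close> to the convex hull.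

  For \<open>x\<^sub>b\<^sub>,\<^sub>k\<close> with \<open>b < d\<close> and \<open>1 \<le> k \<le> m\<close> the weight of a multilinear monomial is the tuple of
  \<open>\<epsilon>\<close>'s of its indices, and a set of tuples is free as soon as any two differ in two blocks.
  On \<open>\<W>\<^sub>N\<close> with \<open>N = r m\<close> (minus \<open>\<J>\<^sub>r\<close>) geometrically growing weights give almost uniform
  marginals, with an error proportional to \<open>2\<^sup>r\<^sup>-\<^sup>N\<close>. The maps \<open>\<sigma>\<^sub>l\<close> have fibres of size \<open>r\<close>, so
  they preserve uniformity, and their fibre indicators span all functions on \<open>[N]\<close>, which pulls the
  separating functional for \<open>\<W>\<^sub>N\<close> back to the blocks. Repeating a block reaches the other degrees.
\<close>

subsection \<open>Finitely supported maps\<close>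

abbreviation lookup :: "('a \<Rightarrow>\<^sub>0 'b::zero) \<Rightarrow> 'a \<Rightarrow> 'b" where
  "lookup \<equiv> Poly_Mapping.lookup"

abbreviation keys :: "('a \<Rightarrow>\<^sub>0 'b::zero) \<Rightarrow> 'a set" where
  "keys \<equiv> Poly_Mapping.keys"

abbreviation single :: "'a \<Rightarrow> 'b \<Rightarrow> 'a \<Rightarrow>\<^sub>0 'b::zero" where
  "single \<equiv> Poly_Mapping.single"

lemma poly_mapping_eq_sum_single:
  fixes p :: "'a \<Rightarrow>\<^sub>0 'b::comm_monoid_add"
  assumes "finite S" "keys p \<subseteq> S"
  shows "p = (\<Sum>a\<in>S. single a (lookup p a))"
  using assms
  by (intro poly_mapping_eqI) (auto simp: lookup_sum lookup_single when_def in_keys_iff subset_iff)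

lemma lookup_sum_single:
  assumes "finite S"
  shows "lookup (\<Sum>a\<in>S. single a (c a)) b = (if b \<in> S then c b else 0)"
  using assms by (simp add: lookup_sum lookup_single when_def)

lemma lookup_scaleR: "lookup (c *\<^sub>R x) a = c *\<^sub>R lookup x a"
  for x :: "'a \<Rightarrow>\<^sub>0 'b::real_vector"
proof -
  have "finite {a. c *\<^sub>R lookup x a \<noteq> 0}"
    by (rule finite_subset[OF _ finite_keys[of x]]) (auto simp: in_keys_iff)
  then show ?thesis by (simp add: scaleR_poly_mapping_def)
qed

lemma scaleR_single: "c *\<^sub>R single a b = single a (c *\<^sub>R b)"
  for b :: "'b::real_vector"
  by (rule poly_mapping_eqI) (simp add: lookup_scaleR lookup_single when_def)

lemma norm_poly_mapping_eq_sum: "norm p = (\<Sum>a\<in>keys p. norm (lookup p a))"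
  for p :: "'a \<Rightarrow>\<^sub>0 'b::real_normed_vector"
  by (simp add: norm_poly_mapping_def dist_poly_mapping_def)

lemma norm_single: "norm (single a b) = norm b"
  for b :: "'b::real_normed_vector"
  by (simp add: norm_poly_mapping_eq_sum)

lemma bounded_linear_single: "bounded_linear (single a :: 'b::real_normed_vector \<Rightarrow> 'a \<Rightarrow>\<^sub>0 'b)"
  by (rule bounded_linear_intro[of _ 1]) (simp_all add: single_add scaleR_single norm_single)

lemma poly_mapping_times_eq_sum:
  fixes p q :: "'a::monoid_add \<Rightarrow>\<^sub>0 'b::semiring_0"
  shows "p * q = (\<Sum>a\<in>keys p. \<Sum>b\<in>keys q. single (a + b) (lookup p a * lookup q b))"
proof -
  have "p * q = (\<Sum>a\<in>keys p. single a (lookup p a)) * (\<Sum>b\<in>keys q. single b (lookup q b))"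
    by (simp flip: poly_mapping_eq_sum_single)
  then show ?thesis by (simp add: sum_product mult_single)
qed

instance poly_mapping :: (monoid_add, real_normed_algebra) real_normed_algebra
proof
  fix r :: real and p q :: "'a \<Rightarrow>\<^sub>0 'b"
  have scaleR: "r *\<^sub>R s = (\<Sum>a\<in>keys s. single a (r *\<^sub>R lookup s a))" for s :: "'a \<Rightarrow>\<^sub>0 'b"
  proof -
    have "r *\<^sub>R s = r *\<^sub>R (\<Sum>a\<in>keys s. single a (lookup s a))"
      by (simp flip: poly_mapping_eq_sum_single)
    then show ?thesis by (simp add: scaleR_sum_right scaleR_single)
  qed
  have scaleR_times: "r *\<^sub>R (p * q)
      = (\<Sum>a\<in>keys p. \<Sum>b\<in>keys q. single (a + b) (r *\<^sub>R (lookup p a * lookup q b)))"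
    by (simp add: poly_mapping_times_eq_sum scaleR_sum_right scaleR_single)
  have "r *\<^sub>R p * q = (\<Sum>a\<in>keys p. single a (r *\<^sub>R lookup p a)) * (\<Sum>b\<in>keys q. single b (lookup q b))"
    by (simp flip: poly_mapping_eq_sum_single scaleR)
  then show "r *\<^sub>R p * q = r *\<^sub>R (p * q)"
    by (simp add: scaleR_times sum_product mult_single)
  have "p * r *\<^sub>R q = (\<Sum>a\<in>keys p. single a (lookup p a)) * (\<Sum>b\<in>keys q. single b (r *\<^sub>R lookup q b))"
    by (simp flip: poly_mapping_eq_sum_single scaleR)
  then show "p * r *\<^sub>R q = r *\<^sub>R (p * q)"
    by (simp add: scaleR_times sum_product mult_single)
  have "norm (p * q) \<le> (\<Sum>a\<in>keys p. \<Sum>b\<in>keys q. norm (lookup p a) * norm (lookup q b))"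
    unfolding poly_mapping_times_eq_sum
    by (intro sum_norm_le) (simp add: norm_single norm_mult_ineq)
  then show "norm (p * q) \<le> norm p * norm q"
    by (simp add: norm_poly_mapping_eq_sum sum_product)
qed

lemma has_vector_derivative_prod:
  fixes f :: "'i \<Rightarrow> real \<Rightarrow> 'a::{real_normed_algebra, comm_ring_1}"
  assumes "finite K" and "\<And>i. i \<in> K \<Longrightarrow> (f i has_vector_derivative f' i) (at x)"
  shows "((\<lambda>t. \<Prod>i\<in>K. f i t) has_vector_derivative (\<Sum>i\<in>K. f' i * (\<Prod>j\<in>K-{i}. f j x))) (at x)"
  using assms
proof (induction K rule: finite_induct)
  case (insert k K)
  have "((\<lambda>t. f k t * (\<Prod>i\<in>K. f i t)) has_vector_derivative
      f k x * (\<Sum>i\<in>K. f' i * (\<Prod>j\<in>K-{i}. f j x)) + f' k * (\<Prod>i\<in>K. f i x)) (at x)"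
    using insert by (intro has_vector_derivative_mult) auto
  moreover have "f k x * (f' i * (\<Prod>j\<in>K-{i}. f j x)) = f' i * (\<Prod>j\<in>insert k K - {i}. f j x)"
    if "i \<in> K" for i
  proof -
    have "insert k K - {i} = insert k (K - {i})" using that insert.hyps by auto
    then show ?thesis using insert.hyps by (simp add: mult_ac)
  qed
  moreover have "insert k K - {k} = K" using insert.hyps by auto
  ultimately show ?case
    using insert.hyps by (simp add: sum_distrib_left add.commute cong: sum.cong)
qed simp

lemma has_vector_derivative_power:
  fixes f :: "real \<Rightarrow> 'a::{real_normed_algebra, comm_ring_1}"
  assumes "(f has_vector_derivative f') (at x)"
  shows "((\<lambda>t. f t ^ k) has_vector_derivative of_nat k * f' * f x ^ (k - 1)) (at x)"
  using has_vector_derivative_prod[of "{..<k}" "\<lambda>_. f" "\<lambda>_. f'" x] assms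
  by (simp add: mult.assoc)

subsection \<open>The matrix exponential\<close>

lemma mat_inverse_eqI:
  fixes A B :: "'a::field mat"
  assumes A: "A \<in> carrier_mat n n" and B: "B \<in> carrier_mat n n" and AB: "A * B = 1\<^sub>m n"
  shows "mat_inverse A = Some B"
proof (cases "mat_inverse A")
  case None
  have "A \<in> Units (ring_mat TYPE('a) n ())"
    using A B AB mat_mult_left_right_inverse[OF A B AB] by (auto simp: Units_def ring_mat_def)
  with mat_inverse(1)[OF A None, where b = "()"] show ?thesis by blast
next
  case (Some C)
  from mat_inverse(2)[OF A Some] have C: "C * A = 1\<^sub>m n" "C \<in> carrier_mat n n" by auto
  have "C = C * (A * B)" using AB C(2) by simp
  also have "\<dots> = (C * A) * B" using A B C(2) by simp
  also have "\<dots> = B" using C B by simp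
  finally show ?thesis using Some by simp
qed

lemma index_mult_mat_sum:
  assumes "A \<in> carrier_mat nr n" "B \<in> carrier_mat n nc" "i < nr" "j < nc"
  shows "(A * B) $$ (i, j) = (\<Sum>l<n. A $$ (i, l) * B $$ (l, j))"
  using assms by (auto simp: scalar_prod_def atLeast0LessThan)

lemma pow_mat_add:
  fixes A :: "'a::semiring_1 mat"
  assumes A: "A \<in> carrier_mat n n"
  shows "A ^\<^sub>m (p + q) = A ^\<^sub>m p * A ^\<^sub>m q"
proof -
  interpret semiring "ring_mat TYPE('a) n ()" by (rule semiring_mat)
  show ?thesis
    using nat_pow_mult[of A p q] A by (simp add: pow_mat_ring_pow[OF A, of _ "()"] ring_mat_def)
qed

lemma index_pow_smult_mat:
  fixes c :: "'a::comm_ring_1"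
  assumes A: "A \<in> carrier_mat n n" and "i < n" "j < n"
  shows "((c \<cdot>\<^sub>m A) ^\<^sub>m k) $$ (i, j) = c ^ k * (A ^\<^sub>m k) $$ (i, j)"
  using assms(2,3)
proof (induction k arbitrary: i j)
  case 0
  then show ?case using A by simp
next
  case (Suc k)
  have "((c \<cdot>\<^sub>m A) ^\<^sub>m Suc k) $$ (i, j) = (\<Sum>l<n. ((c \<cdot>\<^sub>m A) ^\<^sub>m k) $$ (i, l) * (c \<cdot>\<^sub>m A) $$ (l, j))"
    using A Suc.prems
    by (subst pow_mat.simps, intro index_mult_mat_sum[of _ n _ _ n])
       (auto intro: pow_carrier_mat)
  also have "\<dots> = c ^ Suc k * (\<Sum>l<n. (A ^\<^sub>m k) $$ (i, l) * A $$ (l, j))"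
    using A Suc by (simp add: sum_distrib_left mult_ac)
  also have "(\<Sum>l<n. (A ^\<^sub>m k) $$ (i, l) * A $$ (l, j)) = (A ^\<^sub>m Suc k) $$ (i, j)"
    using A Suc.prems
    by (subst pow_mat.simps, intro index_mult_mat_sum[of _ n _ _ n, symmetric])
       (auto intro: pow_carrier_mat)
  finally show ?case .
qed

lemma norm_bound_pow:
  fixes A :: "'a::real_normed_field mat"
  assumes A: "A \<in> carrier_mat n n" and M: "norm_bound A M"
  shows "norm_bound (A ^\<^sub>m k) ((M * real n) ^ k)"
proof (induction k)
  case 0
  then show ?case by (auto simp: norm_bound_def)
next
  case (Suc k)
  from norm_bound_mult[OF pow_carrier_mat[OF A] A Suc M] show ?case by (simp add: mult_ac)
qed

lemma summable_norm_mat_exp: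
  assumes A: "A \<in> carrier_mat n n" and ij: "i < n" "j < n"
  shows "summable (\<lambda>k. norm ((A ^\<^sub>m k) $$ (i, j) / fact k :: complex))"
proof -
  obtain M where "norm_bound A M" using norm_bound_max by blast
  then have "norm ((A ^\<^sub>m k) $$ (i, j)) \<le> (M * real n) ^ k" for k
    using norm_bound_pow[OF A, of M k] A ij
    by (simp add: norm_bound_def pow_mat_dim_square[OF A])
  then have "norm (norm ((A ^\<^sub>m k) $$ (i, j) / fact k)) \<le> inverse (fact k) * (M * real n) ^ k" for k
    by (simp add: norm_divide divide_right_mono field_simps)
  then show ?thesis
    by (intro summable_comparison_test'[OF summable_exp])
qed

lemma mat_exp_carrier [simp]: "A \<in> carrier_mat n n \<Longrightarrow> mat_exp A \<in> carrier_mat n n"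
  by (auto simp: mat_exp_def)

lemma mat_exp_sums:
  assumes A: "A \<in> carrier_mat n n" and ij: "i < n" "j < n"
  shows "(\<lambda>k. (A ^\<^sub>m k) $$ (i, j) / fact k) sums (mat_exp A $$ (i, j))"
  using summable_sums[OF summable_norm_cancel[OF summable_norm_mat_exp[OF assms]]] A ij
  by (simp add: mat_exp_def)

lemma mat_exp_zero: "mat_exp (0\<^sub>m n n) = 1\<^sub>m n"
proof (rule eq_matI)
  fix i j assume "i < dim_row (1\<^sub>m n :: complex mat)" "j < dim_col (1\<^sub>m n :: complex mat)"
  then have ij: "i < n" "j < n" by auto
  have "(0\<^sub>m n n ^\<^sub>m k :: complex mat) $$ (i, j) / fact k = (if k = 0 then 1\<^sub>m n $$ (i, j) else 0)"
    for k
    using ij by (cases k) (auto simp: pow_carrier_mat[of "0\<^sub>m n n" n])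
  then show "mat_exp (0\<^sub>m n n) $$ (i, j) = 1\<^sub>m n $$ (i, j)"
    using mat_exp_sums[of "0\<^sub>m n n" n i j] sums_single[of 0 "\<lambda>_. 1\<^sub>m n $$ (i, j) :: complex"] ij
    by (simp add: sums_unique2)
qed (auto simp: mat_exp_def)

lemma exp_term_add_smult:
  fixes s t :: complex
  assumes A: "A \<in> carrier_mat n n" and ij: "i < n" "j < n"
  shows "(\<Sum>l<n. \<Sum>p\<le>k. (((s \<cdot>\<^sub>m A) ^\<^sub>m p) $$ (i, l) / fact p) *
      (((t \<cdot>\<^sub>m A) ^\<^sub>m (k - p)) $$ (l, j) / fact (k - p)))
    = (((s + t) \<cdot>\<^sub>m A) ^\<^sub>m k) $$ (i, j) / fact k" (is "(\<Sum>l<n. \<Sum>p\<le>k. ?T l p) = _")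
proof -
  have "(\<Sum>l<n. ?T l p) = (s ^ p /\<^sub>R fact p) * (t ^ (k - p) /\<^sub>R fact (k - p)) * (A ^\<^sub>m k) $$ (i, j)"
    if "p \<le> k" for p
  proof -
    have "(A ^\<^sub>m k) $$ (i, j) = (\<Sum>l<n. (A ^\<^sub>m p) $$ (i, l) * (A ^\<^sub>m (k - p)) $$ (l, j))"
      using pow_mat_add[OF A, of p "k - p"] that
        index_mult_mat_sum[OF pow_carrier_mat[OF A] pow_carrier_mat[OF A] ij] by simp
    then show ?thesis
      using ij by (simp add: index_pow_smult_mat[OF A] sum_distrib_left scaleR_conv_of_real
          field_simps)
  qed
  then have "(\<Sum>p\<le>k. \<Sum>l<n. ?T l p) = ((s + t) ^ k /\<^sub>R fact k) * (A ^\<^sub>m k) $$ (i, j)"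
    unfolding exp_series_add_commuting[OF mult.commute] sum_distrib_right by (intro sum.cong) auto
  then show ?thesis
    using ij by (subst sum.swap) (simp add: index_pow_smult_mat[OF A] scaleR_conv_of_real field_simps)
qed

lemma mat_exp_add_smult:
  assumes A: "A \<in> carrier_mat n n"
  shows "mat_exp ((s + t) \<cdot>\<^sub>m A) = mat_exp (s \<cdot>\<^sub>m A) * mat_exp (t \<cdot>\<^sub>m A)"
proof (rule eq_matI)
  fix i j assume "i < dim_row (mat_exp (s \<cdot>\<^sub>m A) * mat_exp (t \<cdot>\<^sub>m A))"
    "j < dim_col (mat_exp (s \<cdot>\<^sub>m A) * mat_exp (t \<cdot>\<^sub>m A))"
  then have ij: "i < n" "j < n" using A by (auto simp: mat_exp_def)
  have carrier: "c \<cdot>\<^sub>m A \<in> carrier_mat n n" for c using A by simp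
  let ?T = "\<lambda>k l p. (((s \<cdot>\<^sub>m A) ^\<^sub>m p) $$ (i, l) / fact p) *
      (((t \<cdot>\<^sub>m A) ^\<^sub>m (k - p)) $$ (l, j) / fact (k - p))"
  have "(\<lambda>k. \<Sum>p\<le>k. ?T k l p) sums (mat_exp (s \<cdot>\<^sub>m A) $$ (i, l) * mat_exp (t \<cdot>\<^sub>m A) $$ (l, j))"
    if l: "l < n" for l
    using Cauchy_product_sums[OF summable_norm_mat_exp[OF carrier ij(1) l]
        summable_norm_mat_exp[OF carrier l ij(2)]]
      mat_exp_sums[OF carrier ij(1) l] mat_exp_sums[OF carrier l ij(2)]
    by (simp add: sums_iff)
  then have "(\<lambda>k. \<Sum>l<n. \<Sum>p\<le>k. ?T k l p)
      sums (\<Sum>l<n. mat_exp (s \<cdot>\<^sub>m A) $$ (i, l) * mat_exp (t \<cdot>\<^sub>m A) $$ (l, j))"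
    by (intro sums_sum) simp
  then have "(\<lambda>k. (((s + t) \<cdot>\<^sub>m A) ^\<^sub>m k) $$ (i, j) / fact k)
      sums ((mat_exp (s \<cdot>\<^sub>m A) * mat_exp (t \<cdot>\<^sub>m A)) $$ (i, j))"
    using exp_term_add_smult[OF A ij]
      index_mult_mat_sum[OF mat_exp_carrier[OF carrier] mat_exp_carrier[OF carrier] ij]
    by simp
  then show "mat_exp ((s + t) \<cdot>\<^sub>m A) $$ (i, j) = (mat_exp (s \<cdot>\<^sub>m A) * mat_exp (t \<cdot>\<^sub>m A)) $$ (i, j)"
    using mat_exp_sums[OF carrier ij] sums_unique2 by blast
qed (use A in \<open>auto simp: mat_exp_def\<close>)

lemma mat_inverse_mat_exp:
  assumes A: "A \<in> carrier_mat n n"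
  shows "mat_inverse (mat_exp (c \<cdot>\<^sub>m A)) = Some (mat_exp ((- c) \<cdot>\<^sub>m A))"
proof (rule mat_inverse_eqI[of _ n])
  have "0 \<cdot>\<^sub>m A = 0\<^sub>m n n" using A by (intro eq_matI) auto
  then show "mat_exp (c \<cdot>\<^sub>m A) * mat_exp ((- c) \<cdot>\<^sub>m A) = 1\<^sub>m n"
    using mat_exp_add_smult[OF A, of c "- c"] by (simp add: mat_exp_zero)
qed (use A in auto)

lemma mat_exp_has_vector_derivative:
  assumes A: "A \<in> carrier_mat n n" and ij: "i < n" "j < n"
  shows "((\<lambda>t. mat_exp ((- complex_of_real t) \<cdot>\<^sub>m A) $$ (i, j))
      has_vector_derivative - A $$ (i, j)) (at 0)"
proof -
  define c where "c k = (A ^\<^sub>m k) $$ (i, j) / fact k" for k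
  have sums: "(\<lambda>k. c k * z ^ k) sums (mat_exp (z \<cdot>\<^sub>m A) $$ (i, j))" for z
    using mat_exp_sums[of "z \<cdot>\<^sub>m A" n i j] A ij by (simp add: c_def index_pow_smult_mat[OF A] mult_ac)
  have "((\<lambda>z. suminf (\<lambda>k. c k * z ^ k))
      has_field_derivative suminf (\<lambda>k. diffs c k * 0 ^ k)) (at (- complex_of_real 0))"
    using sums
    by (simp only: of_real_0 minus_zero)
       (intro termdiffs_strong_converges_everywhere, auto simp: sums_iff)
  then have "((\<lambda>z. mat_exp (z \<cdot>\<^sub>m A) $$ (i, j))
      has_field_derivative A $$ (i, j)) (at (- complex_of_real 0))"
    using A ij sums by (simp add: sums_iff diffs_def c_def powser_zero[of "diffs c"])
  then have "((\<lambda>z. mat_exp ((- z) \<cdot>\<^sub>m A) $$ (i, j))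
      has_field_derivative A $$ (i, j) * - 1) (at (complex_of_real 0))"
    by (rule DERIV_chain2) (auto intro!: derivative_eq_intros)
  then show ?thesis
    using has_vector_derivative_real_field by fastforce
qed

subsection \<open>The action on forms and its derivative\<close>

abbreviation monomial :: "(nat \<Rightarrow>\<^sub>0 nat) \<Rightarrow> mpoly" where
  "monomial a \<equiv> single a 1"

definition exponents :: "nat \<Rightarrow> nat \<Rightarrow> (nat \<Rightarrow>\<^sub>0 nat) set" where
  "exponents n d = {a. keys a \<subseteq> {..<n} \<and> (\<Sum>i<n. lookup a i) = d}"

lemma forms_iff_keys: "p \<in> forms n d \<longleftrightarrow> keys p \<subseteq> exponents n d"
  by (auto simp: forms_def exponents_def)

lemma keys_of_form: "p \<in> forms n d \<Longrightarrow> a \<in> keys p \<Longrightarrow> keys a \<subseteq> {..<n}"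
  by (auto simp: forms_def)

lemma zero_in_forms [simp]: "0 \<in> forms n d"
  by (simp add: forms_iff_keys)

lemma add_in_forms: "p \<in> forms n d \<Longrightarrow> q \<in> forms n d \<Longrightarrow> p + q \<in> forms n d"
  using keys_add[of p q] by (auto simp: forms_iff_keys)

lemma sum_in_forms: "(\<And>x. x \<in> I \<Longrightarrow> f x \<in> forms n d) \<Longrightarrow> sum f I \<in> forms n d"
  by (induction I rule: infinite_finite_induct) (auto simp: add_in_forms)

lemma single_in_forms: "a \<in> exponents n d \<Longrightarrow> single a c \<in> forms n d"
  by (auto simp: forms_iff_keys)

lemma const_mpoly_mult_single: "const_mpoly c * single a b = single a (c * b)"
  by (simp add: const_mpoly_def mult_single)

lemma prod_single_power:
  fixes c :: "nat \<Rightarrow> complex" and e :: "nat \<Rightarrow> nat"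
  assumes "finite K"
  shows "(\<Prod>i\<in>K. single (single i (1::nat)) (c i) ^ e i)
      = single (\<Sum>i\<in>K. single i (e i)) (\<Prod>i\<in>K. c i ^ e i)"
proof -
  have power: "single (single i (1::nat)) (c i) ^ k = single (single i k) (c i ^ k)" for i k
    by (induction k) (simp_all add: mult_single flip: single_add)
  show ?thesis
    using assms by (induction K rule: finite_induct) (simp_all add: power mult_single del: One_nat_def)
qed

definition linear_form :: "nat \<Rightarrow> complex mat \<Rightarrow> nat \<Rightarrow> mpoly" where
  "linear_form n h i = (\<Sum>j<n. single (single j 1) (h $$ (i, j)))"

lemma linear_form_one: "i < n \<Longrightarrow> linear_form n (1\<^sub>m n) i = monomial (single i 1)"
  by (simp add: linear_form_def if_distrib[of "single _"] cong: if_cong)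

lemma linear_form_mat_diag: "i < n \<Longrightarrow> linear_form n (mat_diag n z) i = single (single i 1) (z i)"
  by (simp add: linear_form_def mat_diag_def if_distrib[of "single _"] cong: if_cong)

lemma rep_eq_linear_form:
  assumes "g \<in> carrier_mat n n" "mat_inverse g = Some h"
  shows "rep g p = (\<Sum>a\<in>keys p. const_mpoly (lookup p a) * (\<Prod>i\<in>keys a. linear_form n h i ^ lookup a i))"
  using assms
  by (simp add: rep_def subst_mpoly_def linear_form_def var_mpoly_def const_mpoly_mult_single)

text \<open>\<open>x\<^sub>j \<partial>\<^sub>i\<close> maps \<open>x\<^sup>a\<close> to \<open>a\<^sub>i x\<^sup>b\<close> with \<open>b = exponent_shift a i j\<close>.\<close>

definition exponent_shift :: "(nat \<Rightarrow>\<^sub>0 nat) \<Rightarrow> nat \<Rightarrow> nat \<Rightarrow> (nat \<Rightarrow>\<^sub>0 nat)" where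
  "exponent_shift a i j = a - single i 1 + single j 1"

lemma exponent_shift_add_single:
  assumes "i \<in> keys a"
  shows "exponent_shift a i j + single i 1 = a + single j 1"
  using assms unfolding exponent_shift_def
  by (intro poly_mapping_eqI) (auto simp: lookup_add lookup_minus lookup_single when_def in_keys_iff)

lemma exponent_shift_same: "i \<in> keys a \<Longrightarrow> exponent_shift a i i = a"
  using exponent_shift_add_single[of i a i] by simp

lemma exponent_shift_in_exponents:
  assumes a: "a \<in> exponents n d" and i: "i \<in> keys a" and j: "j < n"
  shows "exponent_shift a i j \<in> exponents n d"
proof -
  have i': "i < n" using a i by (auto simp: exponents_def)
  have "(\<Sum>k<n. lookup (exponent_shift a i j + single i 1) k) = (\<Sum>k<n. lookup (a + single j 1) k)"
    unfolding exponent_shift_add_single[OF i] ..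
  then have "(\<Sum>k<n. lookup (exponent_shift a i j) k) = (\<Sum>k<n. lookup a k)"
    using i' j by (simp add: lookup_add lookup_single when_def sum.distrib)
  moreover have "keys (exponent_shift a i j) \<subseteq> {..<n}"
    using a i' j unfolding exponent_shift_def exponents_def
    by (auto simp: subset_iff in_keys_iff lookup_add lookup_minus lookup_single when_def
          split: if_splits)
  ultimately show ?thesis using a by (simp add: exponents_def)
qed

lemma prod_power_has_vector_derivative:
  fixes f :: "nat \<Rightarrow> real \<Rightarrow> mpoly"
  assumes f': "\<And>i. i \<in> keys a \<Longrightarrow> (f i has_vector_derivative f' i) (at x)"
    and f: "\<And>i. i \<in> keys a \<Longrightarrow> f i x = monomial (single i 1)"
  shows "((\<lambda>t. \<Prod>i\<in>keys a. f i t ^ lookup a i) has_vector_derivative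
    (\<Sum>i\<in>keys a. of_nat (lookup a i) * f' i * monomial (a - single i 1))) (at x)"
proof -
  have "((\<lambda>t. \<Prod>i\<in>keys a. f i t ^ lookup a i) has_vector_derivative
     (\<Sum>i\<in>keys a. (of_nat (lookup a i) * f' i * f i x ^ (lookup a i - 1)) *
        (\<Prod>j\<in>keys a - {i}. f j x ^ lookup a j))) (at x)"
    using f' by (intro has_vector_derivative_prod has_vector_derivative_power) auto
  moreover have "f i x ^ (lookup a i - 1) * (\<Prod>j\<in>keys a - {i}. f j x ^ lookup a j)
      = monomial (a - single i 1)"
    if i: "i \<in> keys a" for i
  proof -
    let ?e = "\<lambda>j. if j = i then lookup a i - 1 else lookup a j"
    have "f i x ^ (lookup a i - 1) * (\<Prod>j\<in>keys a - {i}. f j x ^ lookup a j)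
        = (\<Prod>j\<in>keys a. monomial (single j 1) ^ ?e j)"
      using i f by (subst prod.remove[of "keys a" i]) auto
    also have "\<dots> = monomial (\<Sum>j\<in>keys a. single j (?e j))"
      by (simp add: prod_single_power del: One_nat_def)
    also have "(\<Sum>j\<in>keys a. single j (?e j)) = a - single i 1"
      by (rule poly_mapping_eqI)
         (auto simp: lookup_sum_single lookup_minus lookup_single when_def in_keys_iff)
    finally show ?thesis .
  qed
  ultimately show ?thesis by (simp add: mult.assoc)
qed

lemma rep_mat_exp_has_vector_derivative:
  assumes A: "A \<in> carrier_mat n n" and p: "p \<in> forms n d"
  shows "((\<lambda>t. rep (mat_exp (complex_of_real t \<cdot>\<^sub>m A)) p) has_vector_derivative
    (\<Sum>a\<in>keys p. const_mpoly (lookup p a) *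
      (\<Sum>i\<in>keys a. of_nat (lookup a i) * linear_form n (- A) i * monomial (a - single i 1)))) (at 0)"
proof -
  let ?f = "\<lambda>i t. linear_form n (mat_exp ((- complex_of_real t) \<cdot>\<^sub>m A)) i"
  have rep: "rep (mat_exp (complex_of_real t \<cdot>\<^sub>m A)) p
      = (\<Sum>a\<in>keys p. const_mpoly (lookup p a) * (\<Prod>i\<in>keys a. ?f i t ^ lookup a i))" for t
    using A by (intro rep_eq_linear_form mat_exp_carrier mat_inverse_mat_exp) auto
  have f': "(?f i has_vector_derivative linear_form n (- A) i) (at 0)" if "i < n" for i
    unfolding linear_form_def
  proof (rule has_vector_derivative_sum)
    fix j assume "j \<in> {..<n}"
    then have "((\<lambda>t. mat_exp ((- complex_of_real t) \<cdot>\<^sub>m A) $$ (i, j))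
        has_vector_derivative (- A) $$ (i, j)) (at 0)"
      using mat_exp_has_vector_derivative[OF A that, of j] A that by simp
    then show "((\<lambda>t. single (single j 1) (mat_exp ((- complex_of_real t) \<cdot>\<^sub>m A) $$ (i, j)))
        has_vector_derivative single (single j 1) ((- A) $$ (i, j))) (at 0)"
      by (rule bounded_linear.has_vector_derivative[OF bounded_linear_single])
  qed
  have "(- complex_of_real 0) \<cdot>\<^sub>m A = 0\<^sub>m n n" using A by (intro eq_matI) auto
  then have f_at_0: "?f i 0 = monomial (single i 1)" if "i < n" for i
    using linear_form_one[OF that] by (simp add: mat_exp_zero)
  have "i < n" if "a \<in> keys p" "i \<in> keys a" for a i using keys_of_form[OF p] that by blast
  then show ?thesis
    unfolding rep
    by (intro has_vector_derivative_sum has_vector_derivative_mult_right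
          prod_power_has_vector_derivative f' f_at_0) auto
qed

lemma lie_rep_eq:
  assumes A: "A \<in> carrier_mat n n" and p: "p \<in> forms n d"
  shows "lie_rep A p = (\<Sum>a\<in>keys p. \<Sum>i\<in>keys a. \<Sum>j<n.
     single (exponent_shift a i j) (- lookup p a * of_nat (lookup a i) * A $$ (i, j)))"
proof -
  have "lie_rep A p = (\<Sum>a\<in>keys p. const_mpoly (lookup p a) *
      (\<Sum>i\<in>keys a. of_nat (lookup a i) * linear_form n (- A) i * monomial (a - single i 1)))"
    unfolding lie_rep_def
    by (rule vector_derivative_at[OF rep_mat_exp_has_vector_derivative[OF assms]])
  also have "\<dots> = (\<Sum>a\<in>keys p. \<Sum>i\<in>keys a. const_mpoly (lookup p a) *
      (of_nat (lookup a i) * linear_form n (- A) i * monomial (a - single i 1)))"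
    by (simp only: sum_distrib_left)
  also have "\<dots> = (\<Sum>a\<in>keys p. \<Sum>i\<in>keys a. \<Sum>j<n.
     single (exponent_shift a i j) (- lookup p a * of_nat (lookup a i) * A $$ (i, j)))"
  proof (intro sum.cong refl)
    fix a i assume "a \<in> keys p" "i \<in> keys a"
    then have "i < n" using keys_of_form[OF p] by blast
    then show "const_mpoly (lookup p a) * (of_nat (lookup a i) * linear_form n (- A) i * monomial (a - single i 1))
        = (\<Sum>j<n. single (exponent_shift a i j) (- lookup p a * of_nat (lookup a i) * A $$ (i, j)))"
      using A
      by (simp add: linear_form_def const_mpoly_def exponent_shift_def
            sum_distrib_left sum_distrib_right
            mult_single single_of_nat[symmetric] ac_simps del: single_of_nat)
  qed
  finally show ?thesis .
qed

subsection \<open>The diagonal torus\<close>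

lemma mat_inverse_mat_diag:
  fixes z :: "nat \<Rightarrow> 'a::field"
  assumes "\<And>i. i < n \<Longrightarrow> z i \<noteq> 0"
  shows "mat_inverse (mat_diag n z) = Some (mat_diag n (\<lambda>i. inverse (z i)))"
proof (rule mat_inverse_eqI[of _ n])
  have "mat_diag n z * mat_diag n (\<lambda>i. inverse (z i)) = mat_diag n (\<lambda>i. z i * inverse (z i))"
    by simp
  also have "\<dots> = 1\<^sub>m n" using assms by (auto simp: mat_diag_def)
  finally show "mat_diag n z * mat_diag n (\<lambda>i. inverse (z i)) = 1\<^sub>m n" .
qed auto

lemma det_mat_diag: "Determinant.det (mat_diag n z) = (\<Prod>i<n. z i)"
proof -
  have "Determinant.det (mat_diag n z) = prod_list (diag_mat (mat_diag n z))"
    by (rule det_upper_triangular[of _ n]) (auto simp: mat_diag_def)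
  also have "diag_mat (mat_diag n z) = map z [0..<n]"
    by (auto simp: diag_mat_def mat_diag_def)
  also have "prod_list (map z [0..<n]) = (\<Prod>i<n. z i)"
    by (simp add: prod.distinct_set_conv_list[symmetric] atLeast0LessThan)
  finally show ?thesis .
qed

lemma mat_adjoint_carrier:
  "A \<in> carrier_mat nr nc \<Longrightarrow> mat_adjoint A \<in> carrier_mat nc nr"
  by (auto simp: mat_adjoint_def)

lemma index_mat_adjoint:
  assumes "A \<in> carrier_mat nr nc" "i < nc" "j < nr"
  shows "mat_adjoint A $$ (i, j) = conjugate (A $$ (j, i))"
  using assms by (simp add: mat_adjoint_def mat_of_rows_def)

lemma mat_adjoint_mat_diag: "mat_adjoint (mat_diag n z) = mat_diag n (\<lambda>i. conjugate (z i))"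
proof (rule eq_matI)
  fix i j assume "i < dim_row (mat_diag n (\<lambda>i. conjugate (z i)))"
    "j < dim_col (mat_diag n (\<lambda>i. conjugate (z i)))"
  then show "mat_adjoint (mat_diag n z) $$ (i, j) = mat_diag n (\<lambda>i. conjugate (z i)) $$ (i, j)"
    by (subst index_mat_adjoint[of _ n n]) (auto simp: mat_diag_def)
qed (use mat_adjoint_carrier[OF mat_diag_dim[of n z]] in \<open>auto simp: mat_diag_def\<close>)

lemma mat_diag_in_SL: "(\<Prod>i<n. z i) = 1 \<Longrightarrow> mat_diag n z \<in> SL n"
  by (simp add: SL_def det_mat_diag)

lemma mat_diag_in_SU:
  assumes "(\<Prod>i<n. z i) = 1" "\<And>i. i < n \<Longrightarrow> cmod (z i) = 1"
  shows "mat_diag n z \<in> SU n"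
  using assms
  by (auto simp: SU_def mat_diag_in_SL mat_adjoint_mat_diag complex_norm_square[symmetric])
     (auto simp: mat_diag_def)

lemma rep_mat_diag:
  assumes z: "\<And>i. i < n \<Longrightarrow> z i \<noteq> 0" and p: "p \<in> forms n d"
  shows "rep (mat_diag n z) p
      = (\<Sum>a\<in>keys p. single a (lookup p a * (\<Prod>i<n. inverse (z i) ^ lookup a i)))"
proof -
  have "rep (mat_diag n z) p = (\<Sum>a\<in>keys p. const_mpoly (lookup p a) *
      (\<Prod>i\<in>keys a. linear_form n (mat_diag n (\<lambda>i. inverse (z i))) i ^ lookup a i))"
    using z by (intro rep_eq_linear_form mat_inverse_mat_diag) auto
  also have "\<dots> = (\<Sum>a\<in>keys p. single a (lookup p a * (\<Prod>i<n. inverse (z i) ^ lookup a i)))"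
  proof (rule sum.cong[OF refl])
    fix a assume "a \<in> keys p"
    then have a: "keys a \<subseteq> {..<n}" by (rule keys_of_form[OF p])
    have "(\<Prod>i\<in>keys a. linear_form n (mat_diag n (\<lambda>i. inverse (z i))) i ^ lookup a i)
        = (\<Prod>i\<in>keys a. single (single i 1) (inverse (z i)) ^ lookup a i)"
      using a by (intro prod.cong) (auto simp: linear_form_mat_diag)
    also have "\<dots> = single a (\<Prod>i\<in>keys a. inverse (z i) ^ lookup a i)"
      by (simp add: prod_single_power del: One_nat_def flip: poly_mapping_eq_sum_single)
    also have "(\<Prod>i\<in>keys a. inverse (z i) ^ lookup a i) = (\<Prod>i<n. inverse (z i) ^ lookup a i)"
      using a by (intro prod.mono_neutral_left) (auto simp: in_keys_iff)
    finally show "const_mpoly (lookup p a) *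
        (\<Prod>i\<in>keys a. linear_form n (mat_diag n (\<lambda>i. inverse (z i))) i ^ lookup a i)
      = single a (lookup p a * (\<Prod>i<n. inverse (z i) ^ lookup a i))"
      by (simp add: const_mpoly_mult_single)
  qed
  finally show ?thesis .
qed

text \<open>Along the one-parameter group \<open>t \<mapsto> diag (exp (t y\<^sub>0), \<dots>, exp (t y\<^sub>n\<^sub>-\<^sub>1))\<close> the coefficient of
  \<open>x\<^sup>a\<close> decays like \<open>exp (- t \<langle>y, a\<rangle>)\<close>.\<close>

lemma unstable_if_weights_positive:
  assumes v: "v \<in> forms n d" and y0: "(\<Sum>i<n. y i) = (0::real)"
    and pos: "\<And>a. a \<in> keys v \<Longrightarrow> (\<Sum>i<n. y i * real (lookup a i)) > 0"
  shows "unstable n v"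
proof -
  define g where "g t = mat_diag n (\<lambda>i. complex_of_real (exp (t * y i)))" for t
  have "(\<Prod>i<n. exp (t * y i)) = 1" for t
    using y0 by (simp flip: exp_sum sum_distrib_left)
  then have SL: "g t \<in> SL n" for t
    unfolding g_def by (intro mat_diag_in_SL) (simp flip: of_real_prod)
  have rep: "rep (g t) v
      = (\<Sum>a\<in>keys v. single a (lookup v a * of_real (exp (- t * (\<Sum>i<n. y i * real (lookup a i))))))"
    for t
  proof -
    have "(\<Prod>i<n. inverse (exp (t * y i)) ^ lookup a i) = exp (- t * (\<Sum>i<n. y i * real (lookup a i)))"
      for a
      by (simp add: exp_sum sum_distrib_left mult_ac flip: exp_minus exp_of_nat_mult)
    then show ?thesis
      unfolding g_def
      by (subst rep_mat_diag[OF _ v])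
         (simp_all flip: of_real_inverse of_real_power of_real_prod)
  qed
  have "(\<lambda>k. rep (g (real k)) v) \<longlonglongrightarrow> (\<Sum>a\<in>keys v. single a (lookup v a * of_real 0))"
    unfolding rep
  proof (intro tendsto_sum bounded_linear.tendsto[OF bounded_linear_single] tendsto_mult
      tendsto_const tendsto_of_real)
    fix a assume a: "a \<in> keys v"
    let ?w = "\<Sum>i<n. y i * real (lookup a i)"
    have "exp (- real k * ?w) = exp (- ?w) ^ k" for k
      using exp_of_nat_mult[of k "- ?w"] by simp
    then show "(\<lambda>k. exp (- real k * ?w)) \<longlonglongrightarrow> 0"
      using pos[OF a] by (simp add: LIMSEQ_realpow_zero)
  qed
  then show ?thesis
    unfolding unstable_def closure_sequential using SL
    by (intro exI[of _ "\<lambda>k. rep (g (real k)) v"]) auto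
qed

subsection \<open>Traceless Hermitian matrices\<close>

lemma mat_trace_mult:
  assumes "A \<in> carrier_mat n n" "B \<in> carrier_mat n n"
  shows "mat_trace (A * B) = (\<Sum>i<n. \<Sum>j<n. A $$ (i, j) * B $$ (j, i))"
  using assms unfolding mat_trace_def by (intro sum.cong index_mult_mat_sum) auto

lemma traceless_hermitian_minus:
  assumes A: "A \<in> traceless_hermitian n" and B: "B \<in> traceless_hermitian n"
  shows "A - B \<in> traceless_hermitian n"
proof -
  have carrier: "A \<in> carrier_mat n n" "B \<in> carrier_mat n n" "A - B \<in> carrier_mat n n"
    using A B by (auto simp: traceless_hermitian_def)
  have "mat_adjoint (A - B) = mat_adjoint A - mat_adjoint B"
  proof (rule eq_matI)
    fix i j assume "i < dim_row (mat_adjoint A - mat_adjoint B)"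
      "j < dim_col (mat_adjoint A - mat_adjoint B)"
    then have "i < n" "j < n" using mat_adjoint_carrier[OF carrier(2)] by auto
    then show "mat_adjoint (A - B) $$ (i, j) = (mat_adjoint A - mat_adjoint B) $$ (i, j)"
      using carrier mat_adjoint_carrier[OF carrier(2)] by (simp add: index_mat_adjoint[of _ n n])
  qed (use carrier(3) mat_adjoint_carrier[OF carrier(2)] mat_adjoint_carrier[OF carrier(3)] in auto)
  then show ?thesis
    using A B carrier by (simp add: traceless_hermitian_def mat_trace_def sum_subtractf)
qed

lemma mat_trace_hermitian_square:
  assumes A: "A \<in> carrier_mat n n" and herm: "mat_adjoint A = A"
  shows "mat_trace (A * A) = of_real ((frobenius_norm A)\<^sup>2)"
proof -
  have "A $$ (i, j) * A $$ (j, i) = of_real ((cmod (A $$ (i, j)))\<^sup>2)" if "i < n" "j < n" for i j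
    using index_mat_adjoint[OF A that(2,1)] complex_norm_square[of "A $$ (i, j)"]
    unfolding herm by simp
  then show ?thesis
    using A by (simp add: mat_trace_mult frobenius_norm_def sum_nonneg)
qed

lemma frobenius_norm_eq_0_iff:
  assumes "A \<in> carrier_mat n m"
  shows "frobenius_norm A = 0 \<longleftrightarrow> A = 0\<^sub>m n m"
  using assms by (auto simp: frobenius_norm_def sum_nonneg_eq_0_iff sum_nonneg intro!: eq_matI)

lemma traceless_hermitian_eqI:
  assumes H: "H \<in> traceless_hermitian n" and K: "K \<in> traceless_hermitian n"
    and eq: "\<And>A. A \<in> traceless_hermitian n \<Longrightarrow> mat_trace (H * A) = mat_trace (K * A)"
  shows "H = K"
proof -
  have carrier: "H \<in> carrier_mat n n" "K \<in> carrier_mat n n" "H - K \<in> carrier_mat n n"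
    using H K by (auto simp: traceless_hermitian_def)
  have "mat_trace ((H - K) * (H - K)) = mat_trace (H * (H - K)) - mat_trace (K * (H - K))"
    unfolding mat_trace_mult[OF carrier(3,3)] mat_trace_mult[OF carrier(1,3)]
      mat_trace_mult[OF carrier(2,3)]
    using carrier by (simp add: left_diff_distrib flip: sum_subtractf)
  also have "\<dots> = 0" using eq[OF traceless_hermitian_minus[OF H K]] by simp
  finally have "of_real ((frobenius_norm (H - K))\<^sup>2) = (0::complex)"
    using mat_trace_hermitian_square[OF carrier(3)] traceless_hermitian_minus[OF H K]
    by (simp add: traceless_hermitian_def)
  then have "H - K = 0\<^sub>m n n" using frobenius_norm_eq_0_iff[OF carrier(3)] by simp
  then have "H $$ (i, j) - K $$ (i, j) = 0" if "i < n" "j < n" for i j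
    using that carrier by (metis carrier_matD index_minus_mat(1) index_zero_mat(1))
  then show ?thesis using carrier by (intro eq_matI) auto
qed

lemma moment_map_eqI:
  assumes "H \<in> traceless_hermitian n"
    and "\<And>A. A \<in> traceless_hermitian n \<Longrightarrow> mat_trace (H * A) = ip v (lie_rep A v) / ip v v"
  shows "moment_map n ip v = H"
  unfolding moment_map_def
proof (rule the_equality)
  fix K assume "K \<in> traceless_hermitian n \<and>
     (\<forall>A\<in>traceless_hermitian n. mat_trace (K * A) = ip v (lie_rep A v) / ip v v)"
  then show "K = H" using assms by (intro traceless_hermitian_eqI[of K n H]) auto
qed (use assms in auto)

lemma frobenius_norm_mat_diag: "frobenius_norm (mat_diag n z) = sqrt (\<Sum>i<n. (cmod (z i))\<^sup>2)"
  by (simp add: frobenius_norm_def mat_diag_def if_distrib[of "\<lambda>z. (cmod z)\<^sup>2"] cong: if_cong)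

subsection \<open>Invariant inner products\<close>

lemma exponents_distinctE:
  assumes "a \<in> exponents n d" "b \<in> exponents n d" "a \<noteq> b"
  obtains i j where "i < n" "j < n" "lookup b i < lookup a i" "lookup a j < lookup b j"
proof -
  have exists_greater: "\<exists>i<n. lookup b i < lookup a i"
    if ab: "a \<in> exponents n d" "b \<in> exponents n d" "a \<noteq> b" for a b
  proof (rule ccontr)
    assume "\<not> ?thesis"
    then have le: "lookup a i \<le> lookup b i" if "i < n" for i
      using that by (meson not_less)
    obtain k where k: "lookup a k \<noteq> lookup b k" using ab(3) by (metis poly_mapping_eqI)
    then have "k \<in> keys a \<union> keys b" by (auto simp: in_keys_iff)
    then have "k < n" using ab by (auto simp: exponents_def)
    then have "(\<Sum>i<n. lookup a i) < (\<Sum>i<n. lookup b i)"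
      using le k by (intro sum_strict_mono_ex1) (auto intro!: bexI[of _ k] simp: order_less_le)
    then show False using ab by (simp add: exponents_def)
  qed
  from exists_greater[OF assms] exists_greater[OF assms(2,1) assms(3)[symmetric]] that
  show ?thesis by blast
qed

locale SU_invariant_inner_product =
  fixes n d :: nat and ip :: "mpoly \<Rightarrow> mpoly \<Rightarrow> complex"
  assumes SU_invariant: "SU_invariant_inner n d ip"
begin

lemma ip_cnj: "p \<in> forms n d \<Longrightarrow> q \<in> forms n d \<Longrightarrow> ip q p = cnj (ip p q)"
  using SU_invariant unfolding SU_invariant_inner_def by blast

lemma ip_add: "p \<in> forms n d \<Longrightarrow> q \<in> forms n d \<Longrightarrow> r \<in> forms n d \<Longrightarrow> ip p (q + r) = ip p q + ip p r"
  using SU_invariant unfolding SU_invariant_inner_def by blast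

lemma ip_scale: "p \<in> forms n d \<Longrightarrow> q \<in> forms n d \<Longrightarrow> ip p (const_mpoly c * q) = c * ip p q"
  using SU_invariant unfolding SU_invariant_inner_def by blast

lemma ip_pos: "p \<in> forms n d \<Longrightarrow> p \<noteq> 0 \<Longrightarrow> Re (ip p p) > 0"
  using SU_invariant unfolding SU_invariant_inner_def by blast

lemma ip_rep: "g \<in> SU n \<Longrightarrow> p \<in> forms n d \<Longrightarrow> q \<in> forms n d \<Longrightarrow> ip (rep g p) (rep g q) = ip p q"
  using SU_invariant unfolding SU_invariant_inner_def by blast

lemma ip_sum:
  assumes p: "p \<in> forms n d" and "\<And>x. x \<in> I \<Longrightarrow> f x \<in> forms n d"
  shows "ip p (sum f I) = (\<Sum>x\<in>I. ip p (f x))"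
proof -
  have "ip p 0 = 0" using ip_scale[OF p zero_in_forms, of 0] by simp
  with assms(2) show ?thesis
    by (induction I rule: infinite_finite_induct) (auto simp: ip_add[OF p] sum_in_forms)
qed

lemma ip_single:
  assumes "p \<in> forms n d" "a \<in> exponents n d"
  shows "ip p (single a c) = c * ip p (monomial a)"
  using ip_scale[OF assms(1) single_in_forms[OF assms(2)], of c 1]
  by (simp add: const_mpoly_mult_single)

lemma ip_single_single:
  assumes a: "a \<in> exponents n d" and b: "b \<in> exponents n d"
  shows "ip (single a c) (single b e) = cnj c * e * ip (monomial a) (monomial b)"
proof -
  note forms = single_in_forms[OF a] single_in_forms[OF b]
  have "ip (single a c) (monomial b) = cnj (ip (monomial b) (single a c))"
    by (rule ip_cnj[OF forms(2,1)])
  also have "\<dots> = cnj c * cnj (ip (monomial b) (monomial a))"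
    unfolding ip_single[OF forms(2) a, of 1 c] by simp
  also have "cnj (ip (monomial b) (monomial a)) = ip (monomial a) (monomial b)"
    by (rule ip_cnj[OF forms(2,1), symmetric])
  finally show ?thesis unfolding ip_single[OF forms(1) b, of c e] by simp
qed

lemma ip_monomials_torus:
  assumes a: "a \<in> exponents n d" and b: "b \<in> exponents n d"
    and z: "(\<Prod>i<n. z i) = 1" "\<And>i. i < n \<Longrightarrow> cmod (z i) = 1"
  shows "ip (monomial a) (monomial b)
    = cnj (\<Prod>i<n. inverse (z i) ^ lookup a i) * (\<Prod>i<n. inverse (z i) ^ lookup b i) *
      ip (monomial a) (monomial b)"
proof -
  have "z i \<noteq> 0" if "i < n" for i using z(2)[OF that] by auto
  then have rep: "rep (mat_diag n z) (monomial e) = single e (\<Prod>i<n. inverse (z i) ^ lookup e i)"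
    if "e \<in> exponents n d" for e
    using rep_mat_diag[of n z "monomial e" d] single_in_forms[OF that] by simp
  have "ip (monomial a) (monomial b)
      = ip (rep (mat_diag n z) (monomial a)) (rep (mat_diag n z) (monomial b))"
    by (intro ip_rep[symmetric] mat_diag_in_SU single_in_forms a b z)
  also have "\<dots> = cnj (\<Prod>i<n. inverse (z i) ^ lookup a i) * (\<Prod>i<n. inverse (z i) ^ lookup b i) *
      ip (monomial a) (monomial b)"
    unfolding rep[OF a] rep[OF b] by (rule ip_single_single[OF a b])
  finally show ?thesis .
qed

text \<open>A torus element of \<open>SU(n)\<close> that acts on the two monomials by scalars with quotient \<open>-1\<close>.\<close>

lemma ip_monomials_orthogonal:
  assumes a: "a \<in> exponents n d" and b: "b \<in> exponents n d" and ab: "a \<noteq> b"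
  shows "ip (monomial a) (monomial b) = 0"
proof -
  obtain i j where ij: "i < n" "j < n" "lookup b i < lookup a i" "lookup a j < lookup b j"
    using exponents_distinctE[OF a b ab] by blast
  then have "i \<noteq> j" by auto
  define \<theta> where
    "\<theta> = pi / ((real (lookup a i) - real (lookup b i)) + (real (lookup b j) - real (lookup a j)))"
  define z where "z k = (if k = i then cis \<theta> else if k = j then cis (- \<theta>) else 1)" for k
  have prod_pair: "(\<Prod>k<n. if k = i then u else if k = j then v else 1) = u * v" for u v :: complex
  proof -
    have "(\<Prod>k<n. if k = i then u else if k = j then v else 1) =
       (\<Prod>k\<in>{i, j}. if k = i then u else if k = j then v else 1)"
      using ij by (intro prod.mono_neutral_right) auto
    then show ?thesis using \<open>i \<noteq> j\<close> by simp
  qed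
  have character: "(\<Prod>k<n. inverse (z k) ^ lookup e k)
      = cis (- \<theta> * (real (lookup e i) - real (lookup e j)))" for e
  proof -
    have "(\<Prod>k<n. inverse (z k) ^ lookup e k)
        = (\<Prod>k<n. if k = i then cis (- \<theta>) ^ lookup e i else if k = j then cis \<theta> ^ lookup e j else 1)"
      by (intro prod.cong) (auto simp: z_def)
    then show ?thesis by (simp add: prod_pair DeMoivre cis_mult algebra_simps)
  qed
  have "(\<Prod>k<n. z k) = 1" by (simp add: z_def prod_pair cis_mult)
  moreover have "cnj (cis (- \<theta> * (real (lookup a i) - real (lookup a j))))
      * cis (- \<theta> * (real (lookup b i) - real (lookup b j)))
      = cis (\<theta> * ((real (lookup a i) - real (lookup b i)) + (real (lookup b j) - real (lookup a j))))"
    by (simp add: cis_cnj cis_mult algebra_simps)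
  moreover have "\<dots> = - 1" using ij unfolding \<theta>_def by simp
  ultimately have "ip (monomial a) (monomial b) = - ip (monomial a) (monomial b)"
    using ip_monomials_torus[OF a b, of z] unfolding character by (simp add: z_def)
  then show ?thesis by simp
qed

definition monomial_norm_square :: "(nat \<Rightarrow>\<^sub>0 nat) \<Rightarrow> real" where
  "monomial_norm_square a = Re (ip (monomial a) (monomial a))"

lemma monomial_norm_square_pos: "a \<in> exponents n d \<Longrightarrow> monomial_norm_square a > 0"
  unfolding monomial_norm_square_def
  by (intro ip_pos single_in_forms) (simp_all flip: keys_eq_empty)

lemma ip_monomial_self:
  assumes "a \<in> exponents n d"
  shows "ip (monomial a) (monomial a) = of_real (monomial_norm_square a)"
  using ip_cnj[of "monomial a" "monomial a"] assms
  by (simp add: monomial_norm_square_def single_in_forms complex_eq_iff)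

lemma ip_form_single:
  assumes p: "p \<in> forms n d" and b: "b \<in> exponents n d"
  shows "ip p (single b c) = c * cnj (lookup p b) * of_real (monomial_norm_square b)"
proof -
  have keys: "a \<in> exponents n d" if "a \<in> keys p" for a using p that by (auto simp: forms_iff_keys)
  have "ip (monomial b) p = ip (monomial b) (\<Sum>a\<in>keys p. single a (lookup p a))"
    by (simp flip: poly_mapping_eq_sum_single)
  also have "\<dots> = (\<Sum>a\<in>keys p. ip (monomial b) (single a (lookup p a)))"
    by (intro ip_sum single_in_forms b keys)
  also have "\<dots> = (\<Sum>a\<in>keys p. lookup p a * ip (monomial b) (monomial a))"
    by (intro sum.cong ip_single single_in_forms b keys) auto
  also have "\<dots> = (\<Sum>a\<in>keys p. if a = b then lookup p b * of_real (monomial_norm_square b) else 0)"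
    using b keys by (intro sum.cong) (auto simp: ip_monomial_self ip_monomials_orthogonal)
  also have "\<dots> = lookup p b * of_real (monomial_norm_square b)"
    by (simp add: in_keys_iff)
  finally show ?thesis
    using ip_cnj[OF single_in_forms[OF b] p, of 1] ip_single[OF p b, of c] by simp
qed

definition mass :: "mpoly \<Rightarrow> (nat \<Rightarrow>\<^sub>0 nat) \<Rightarrow> real" where
  "mass p a = (cmod (lookup p a))\<^sup>2 * monomial_norm_square a"

lemma ip_self:
  assumes p: "p \<in> forms n d"
  shows "ip p p = of_real (\<Sum>a\<in>keys p. mass p a)"
proof -
  have keys: "a \<in> exponents n d" if "a \<in> keys p" for a using p that by (auto simp: forms_iff_keys)
  have "ip p p = ip p (\<Sum>a\<in>keys p. single a (lookup p a))"
    by (simp flip: poly_mapping_eq_sum_single)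
  also have "\<dots> = (\<Sum>a\<in>keys p. ip p (single a (lookup p a)))"
    by (intro ip_sum single_in_forms p keys)
  also have "\<dots> = (\<Sum>a\<in>keys p. of_real (mass p a))"
    using keys
    by (intro sum.cong)
       (auto simp: p ip_form_single mass_def complex_norm_square simp del: of_real_power)
  finally show ?thesis by simp
qed

end

subsection \<open>The moment map on free supports\<close>

text \<open>No two elements differ by a root \<open>e\<^sub>i - e\<^sub>j\<close>, stated without subtraction.\<close>

definition free_exponents :: "nat \<Rightarrow> (nat \<Rightarrow>\<^sub>0 nat) set \<Rightarrow> bool" where
  "free_exponents n S \<longleftrightarrow> (\<forall>a\<in>S. \<forall>b\<in>S. \<forall>i<n. \<forall>j<n. a + single i 1 = b + single j 1 \<longrightarrow> a = b)"

lemma free_exponents_subset: "free_exponents n S \<Longrightarrow> T \<subseteq> S \<Longrightarrow> free_exponents n T"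
  unfolding free_exponents_def by blast

lemma free_exponents_shift_iff:
  assumes free: "free_exponents n S" and a: "a \<in> S" "i \<in> keys a" "i < n" "j < n"
  shows "exponent_shift a i j \<in> S \<longleftrightarrow> i = j"
proof
  assume "exponent_shift a i j \<in> S"
  then have "exponent_shift a i j = a"
    using free a exponent_shift_add_single[OF a(2), of j] unfolding free_exponents_def by metis
  then have "single i (1::nat) = single j 1" using exponent_shift_add_single[OF a(2), of j] by simp
  then show "i = j" by (metis keys_single singleton_inject zero_neq_one)
qed (use a exponent_shift_same in simp)

context SU_invariant_inner_product
begin

lemma ip_lie_rep_free:
  assumes A: "A \<in> carrier_mat n n" and v: "v \<in> forms n d" and free: "free_exponents n (keys v)"
  shows "ip v (lie_rep A v)
      = - (\<Sum>i<n. of_real (\<Sum>a\<in>keys v. mass v a * real (lookup a i)) * A $$ (i, i))"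
proof -
  let ?T = "\<lambda>a i j. single (exponent_shift a i j) (- lookup v a * of_nat (lookup a i) * A $$ (i, j))"
  have keys: "a \<in> exponents n d" if "a \<in> keys v" for a using v that by (auto simp: forms_iff_keys)
  have shift: "exponent_shift a i j \<in> exponents n d" if "a \<in> keys v" "i \<in> keys a" "j < n" for a i j
    using exponent_shift_in_exponents keys that by blast
  have "ip v (lie_rep A v) = (\<Sum>a\<in>keys v. ip v (\<Sum>i\<in>keys a. \<Sum>j<n. ?T a i j))"
    unfolding lie_rep_eq[OF A v] by (intro ip_sum sum_in_forms single_in_forms v shift) auto
  also have "\<dots> = (\<Sum>a\<in>keys v. \<Sum>i\<in>keys a. ip v (\<Sum>j<n. ?T a i j))"
    by (intro sum.cong refl ip_sum sum_in_forms single_in_forms v shift) auto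
  also have "\<dots> = (\<Sum>a\<in>keys v. \<Sum>i\<in>keys a. \<Sum>j<n. ip v (?T a i j))"
    by (intro sum.cong refl ip_sum sum_in_forms single_in_forms v shift) auto
  also have "\<dots> = (\<Sum>a\<in>keys v. \<Sum>i\<in>keys a. \<Sum>j<n.
      if j = i then - of_real (mass v a * real (lookup a i)) * A $$ (i, i) else 0)"
  proof (intro sum.cong refl)
    fix a i j assume aij: "a \<in> keys v" "i \<in> keys a" "j \<in> {..<n}"
    then have "i < n" using keys_of_form[OF v] by blast
    then have "exponent_shift a i j \<in> keys v \<longleftrightarrow> i = j"
      using free_exponents_shift_iff[OF free] aij by auto
    then show "ip v (?T a i j)
        = (if j = i then - of_real (mass v a * real (lookup a i)) * A $$ (i, i) else 0)"
      using aij shift v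
      by (auto simp: ip_form_single exponent_shift_same in_keys_iff mass_def complex_norm_square
          simp del: of_real_power)
  qed
  also have "\<dots> = (\<Sum>a\<in>keys v. \<Sum>i\<in>keys a. - of_real (mass v a * real (lookup a i)) * A $$ (i, i))"
    using keys_of_form[OF v] by (intro sum.cong refl) auto
  also have "\<dots> = (\<Sum>a\<in>keys v. \<Sum>i<n. - of_real (mass v a * real (lookup a i)) * A $$ (i, i))"
    using keys_of_form[OF v] by (intro sum.cong refl sum.mono_neutral_left) (auto simp: in_keys_iff)
  also have "\<dots> = - (\<Sum>i<n. of_real (\<Sum>a\<in>keys v. mass v a * real (lookup a i)) * A $$ (i, i))"
    by (subst sum.swap) (simp add: sum_negf sum_distrib_right)
  finally show ?thesis .
qed

lemma moment_map_free:
  assumes n: "n > 0" and v: "v \<in> forms n d" and free: "free_exponents n (keys v)"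
    and mass: "(\<Sum>a\<in>keys v. mass v a) = 1"
  shows "moment_map n ip v
      = mat_diag n (\<lambda>i. of_real (real d / real n - (\<Sum>a\<in>keys v. mass v a * real (lookup a i))))"
proof (rule moment_map_eqI)
  let ?w = "\<lambda>i. \<Sum>a\<in>keys v. mass v a * real (lookup a i)"
  let ?H = "mat_diag n (\<lambda>i. complex_of_real (real d / real n - ?w i))"
  have "(\<Sum>i<n. ?w i) = (\<Sum>a\<in>keys v. mass v a * real (\<Sum>i<n. lookup a i))"
    by (subst sum.swap) (simp add: sum_distrib_left)
  also have "\<dots> = real d"
    using v mass by (simp add: forms_def sum_distrib_right[symmetric])
  finally have "(\<Sum>i<n. real d / real n - ?w i) = 0"
    using n by (simp add: sum_subtractf)
  moreover have "mat_trace ?H = of_real (\<Sum>i<n. real d / real n - ?w i)"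
    by (simp add: mat_trace_def mat_diag_def)
  ultimately have "mat_trace ?H = 0" by (simp only: of_real_0)
  then show "?H \<in> traceless_hermitian n"
    by (simp add: traceless_hermitian_def mat_adjoint_mat_diag)
  fix A assume "A \<in> traceless_hermitian n"
  then have A: "A \<in> carrier_mat n n" and trace: "(\<Sum>i<n. A $$ (i, i)) = 0"
    by (auto simp: traceless_hermitian_def mat_trace_def)
  have "mat_trace (?H * A) = (\<Sum>i<n. of_real (real d / real n - ?w i) * A $$ (i, i))"
    using A by (simp add: mat_trace_def mat_diag_mult_left)
  also have "\<dots>
      = of_real (real d / real n) * (\<Sum>i<n. A $$ (i, i)) - (\<Sum>i<n. of_real (?w i) * A $$ (i, i))"
    by (simp add: left_diff_distrib sum_subtractf sum_distrib_left)
  also have "\<dots> = ip v (lie_rep A v) / ip v v"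
    unfolding trace ip_lie_rep_free[OF A v free] ip_self[OF v] mass by simp
  finally show "mat_trace (?H * A) = ip v (lie_rep A v) / ip v v" .
qed

lemma obtain_form_with_masses:
  assumes fin: "finite S" and S: "S \<subseteq> exponents n d" and lam: "\<And>a. a \<in> S \<Longrightarrow> lam a \<ge> 0"
  obtains v where "v \<in> forms n d" "keys v \<subseteq> S" "\<And>a. a \<in> S \<Longrightarrow> mass v a = lam a"
proof
  let ?v = "\<Sum>a\<in>S. single a (complex_of_real (sqrt (lam a / monomial_norm_square a)))"
  show "keys ?v \<subseteq> S" by (auto simp: in_keys_iff lookup_sum_single[OF fin] split: if_splits)
  then show "?v \<in> forms n d" using S by (auto simp: forms_iff_keys)
  show "mass ?v a = lam a" if "a \<in> S" for a
    using that lam[OF that] monomial_norm_square_pos[of a] S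
    by (auto simp: mass_def lookup_sum_single[OF fin] simp flip: of_real_power)
qed

lemma gap_le_free_exponents:
  assumes n: "n > 0" and fin: "finite S" and S: "S \<subseteq> exponents n d" and free: "free_exponents n S"
    and y0: "(\<Sum>i<n. y i) = (0::real)" and y: "\<And>a. a \<in> S \<Longrightarrow> (\<Sum>i<n. y i * real (lookup a i)) > 0"
    and lam: "\<And>a. a \<in> S \<Longrightarrow> lam a \<ge> 0" and lam1: "sum lam S = 1"
  shows "gap n d ip \<le> sqrt (\<Sum>i<n. ((\<Sum>a\<in>S. lam a * real (lookup a i)) - real d / real n)\<^sup>2)"
proof -
  obtain v where v: "v \<in> forms n d" and keys: "keys v \<subseteq> S" and mass: "\<And>a. a \<in> S \<Longrightarrow> mass v a = lam a"
    using obtain_form_with_masses[OF fin S, of lam] lam by blast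
  have lam_sum: "(\<Sum>a\<in>keys v. mass v a * f a) = (\<Sum>a\<in>S. lam a * f a)" for f
    using keys fin
    by (intro sum.mono_neutral_cong_left)
       (auto simp: mass_def in_keys_iff simp flip: mass)
  have total: "(\<Sum>a\<in>keys v. mass v a) = 1" using lam_sum[of "\<lambda>_. 1"] lam1 by simp
  then have "v \<noteq> 0" by auto
  moreover have "unstable n v"
    using keys y by (intro unstable_if_weights_positive[OF v y0]) auto
  ultimately have "gap n d ip \<le> frobenius_norm (moment_map n ip v)"
    unfolding gap_def using v
    by (intro cInf_lower bdd_belowI[of _ 0]) (auto simp: frobenius_norm_def intro!: sum_nonneg)
  also have "moment_map n ip v
      = mat_diag n (\<lambda>i. of_real (real d / real n - (\<Sum>a\<in>S. lam a * real (lookup a i))))"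
    unfolding moment_map_free[OF n v free_exponents_subset[OF free keys] total] lam_sum ..
  also have "frobenius_norm \<dots> = sqrt (\<Sum>i<n. ((\<Sum>a\<in>S. lam a * real (lookup a i)) - real d / real n)\<^sup>2)"
    unfolding frobenius_norm_mat_diag norm_of_real by (simp add: power2_commute)
  finally show ?thesis .
qed

end

subsection \<open>Multilinear monomials\<close>

text \<open>The number of the variable \<open>x\<^sub>b\<^sub>,\<^sub>k\<close>, where \<open>k\<close> counts from \<open>1\<close>.\<close>

definition block_var :: "nat \<Rightarrow> nat \<Rightarrow> nat \<Rightarrow> nat" where
  "block_var m b k = b * m + (k - 1)"

definition tuple_exponent :: "nat \<Rightarrow> nat list \<Rightarrow> nat \<Rightarrow>\<^sub>0 nat" where
  "tuple_exponent m xs = (\<Sum>b<length xs. single (block_var m b (xs ! b)) 1)"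

lemma block_var_div_mod:
  assumes "k \<in> {1..m}"
  shows "block_var m b k div m = b" "block_var m b k mod m = k - 1"
proof -
  obtain l where "k = Suc l" "l < m" using assms by (cases k) auto
  then show "block_var m b k div m = b" "block_var m b k mod m = k - 1"
    by (simp_all add: block_var_def)
qed

lemma block_var_eq_iff:
  assumes "k \<in> {1..m}" "l \<in> {1..m}"
  shows "block_var m b k = block_var m c l \<longleftrightarrow> b = c \<and> k = l"
proof
  assume eq: "block_var m b k = block_var m c l"
  have "b = c" "k - 1 = l - 1"
    using block_var_div_mod[OF assms(1), of b] block_var_div_mod[OF assms(2), of c]
    unfolding eq by simp_all
  then show "b = c \<and> k = l" using assms by auto
qed simp

lemma block_var_less:
  assumes "k \<in> {1..m}" "b < d"
  shows "block_var m b k < d * m"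
proof -
  have "block_var m b k < Suc b * m" using assms(1) by (auto simp: block_var_def)
  also have "\<dots> \<le> d * m" using assms(2) by (intro mult_le_mono1) auto
  finally show ?thesis .
qed

lemma sum_block_var: "(\<Sum>i<d * m. f i) = (\<Sum>b<d. \<Sum>k=1..m. f (block_var m b k))"
proof -
  have "(\<Sum>i<d * m. f i) = (\<Sum>b<d. sum f {b * m..<b * m + m})"
    by (rule sum.nat_group[symmetric])
  also have "\<dots> = (\<Sum>b<d. \<Sum>k=1..m. f (block_var m b k))"
  proof (rule sum.cong[OF refl])
    fix b
    show "sum f {b * m..<b * m + m} = (\<Sum>k=1..m. f (block_var m b k))"
      by (rule sum.reindex_bij_witness[of _ "block_var m b" "\<lambda>i. i - b * m + 1"])
         (auto simp: block_var_def)
  qed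
  finally show ?thesis .
qed

lemma lookup_tuple_exponent:
  assumes xs: "set xs \<subseteq> {1..m}" and k: "k \<in> {1..m}"
  shows "lookup (tuple_exponent m xs) (block_var m b k) = of_bool (b < length xs \<and> xs ! b = k)"
proof -
  have "xs ! c \<in> {1..m}" if "c < length xs" for c using xs that nth_mem by blast
  then have "lookup (tuple_exponent m xs) (block_var m b k)
      = (\<Sum>c<length xs. if c = b then of_bool (xs ! b = k) else 0)"
    unfolding tuple_exponent_def lookup_sum using k
    by (intro sum.cong) (auto simp: lookup_single when_def block_var_eq_iff)
  then show ?thesis by simp
qed

lemma sum_tuple_exponent:
  fixes f :: "nat \<Rightarrow> 'a::comm_semiring_1"
  assumes xs: "set xs \<subseteq> {1..m}" "length xs = d"
  shows "(\<Sum>i<d * m. f i * of_nat (lookup (tuple_exponent m xs) i))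
      = (\<Sum>b<d. f (block_var m b (xs ! b)))"
proof -
  have range: "xs ! b \<in> {1..m}" if "b < d" for b using xs that nth_mem by blast
  have "(\<Sum>i<d * m. f i * of_nat (lookup (tuple_exponent m xs) i))
      = (\<Sum>b<d. \<Sum>k=1..m. if k = xs ! b then f (block_var m b k) else 0)"
    unfolding sum_block_var using xs by (intro sum.cong refl) (auto simp: lookup_tuple_exponent)
  also have "\<dots> = (\<Sum>b<d. f (block_var m b (xs ! b)))"
    using range by (intro sum.cong refl) simp
  finally show ?thesis .
qed

lemma tuple_exponent_in_exponents:
  assumes xs: "set xs \<subseteq> {1..m}" "length xs = d"
  shows "tuple_exponent m xs \<in> exponents (d * m) d"
proof -
  have "xs ! b \<in> {1..m}" if "b < d" for b using xs that nth_mem by blast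
  then have "(\<Union>b<length xs. {block_var m b (xs ! b)}) \<subseteq> {..<d * m}"
    using block_var_less xs(2) by auto
  moreover have "keys (tuple_exponent m xs)
      \<subseteq> (\<Union>b<length xs. keys (single (block_var m b (xs ! b)) (1::nat)))"
    unfolding tuple_exponent_def by (rule keys_sum)
  ultimately have "keys (tuple_exponent m xs) \<subseteq> {..<d * m}" by auto
  moreover have "(\<Sum>i<d * m. lookup (tuple_exponent m xs) i) = d"
    using sum_tuple_exponent[OF xs, of "\<lambda>_. 1::nat"] by simp
  ultimately show ?thesis by (simp add: exponents_def)
qed

definition hamming_distance :: "'a list \<Rightarrow> 'a list \<Rightarrow> nat" where
  "hamming_distance xs ys = length (filter (\<lambda>(x, y). x \<noteq> y) (zip xs ys))"

lemma hamming_distance_append: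
  assumes "length xs = length ys"
  shows "hamming_distance (xs @ xs') (ys @ ys') = hamming_distance xs ys + hamming_distance xs' ys'"
  using assms by (simp add: hamming_distance_def)

lemma hamming_distance_pos:
  assumes "length xs = length ys" "xs \<noteq> ys"
  shows "0 < hamming_distance xs ys"
  using assms list_eq_iff_zip_eq[of xs ys] by (auto simp: hamming_distance_def filter_empty_conv)

lemma hamming_distance_ge_2E:
  assumes "length xs = length ys" "2 \<le> hamming_distance xs ys"
  obtains b c where "b < length xs" "c < length xs" "b \<noteq> c" "xs ! b \<noteq> ys ! b" "xs ! c \<noteq> ys ! c"
proof -
  let ?D = "{b. b < length xs \<and> xs ! b \<noteq> ys ! b}"
  have "hamming_distance xs ys = card ?D"
    using assms(1) by (simp add: hamming_distance_def length_filter_conv_card cong: conj_cong)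
  then have "\<not> card ?D \<le> Suc 0" using assms(2) by simp
  then have "\<exists>b\<in>?D. \<exists>c\<in>?D. b \<noteq> c" by (subst (asm) card_le_Suc0_iff_eq) auto
  then show thesis using that by blast
qed

text \<open>If the exponents differ by \<open>e\<^sub>j - e\<^sub>i\<close>, every block in which the tuples differ must contain
  \<open>x\<^sub>j\<close>.\<close>

lemma tuple_exponent_free:
  assumes xs: "set xs \<subseteq> {1..m}" and ys: "set ys \<subseteq> {1..m}" and len: "length xs = length ys"
    and far: "2 \<le> hamming_distance xs ys"
  shows "tuple_exponent m xs + single i 1 \<noteq> tuple_exponent m ys + single j 1"
proof
  assume eq: "tuple_exponent m xs + single i 1 = tuple_exponent m ys + single j 1"
  have range: "xs ! b \<in> {1..m}" if "b < length xs" for b using xs that nth_mem by blast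
  have j: "j = block_var m b (xs ! b)" if b: "b < length xs" "xs ! b \<noteq> ys ! b" for b
  proof -
    let ?i = "block_var m b (xs ! b)"
    have "1 \<le> lookup (tuple_exponent m xs + single i 1) ?i"
      using lookup_tuple_exponent[OF xs range[OF b(1)]] b by (simp add: lookup_add)
    moreover have "lookup (tuple_exponent m ys) ?i = 0"
      using lookup_tuple_exponent[OF ys range[OF b(1)]] b by simp
    ultimately show ?thesis
      unfolding eq by (simp add: lookup_add lookup_single when_def split: if_splits)
  qed
  obtain b c where bc: "b < length xs" "c < length xs" "b \<noteq> c" "xs ! b \<noteq> ys ! b" "xs ! c \<noteq> ys ! c"
    using hamming_distance_ge_2E[OF len far] by blast
  then have "block_var m b (xs ! b) = block_var m c (xs ! c)" using j[of b] j[of c] by simp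
  then show False using bc range by (simp add: block_var_eq_iff)
qed

definition tuple_eval :: "('a \<Rightarrow> real) list \<Rightarrow> 'a list \<Rightarrow> real" where
  "tuple_eval ys xs = sum_list (map2 (\<lambda>y x. y x) ys xs)"

lemma tuple_eval_append:
  "length ys = length xs \<Longrightarrow> tuple_eval (ys @ ys') (xs @ xs') = tuple_eval ys xs + tuple_eval ys' xs'"
  by (simp add: tuple_eval_def)

lemma tuple_eval_map: "tuple_eval (map f ls) (map g ls) = (\<Sum>l\<leftarrow>ls. f l (g l))"
  by (induction ls) (simp_all add: tuple_eval_def)

lemma tuple_eval_eq_sum:
  "length ys = length xs \<Longrightarrow> tuple_eval ys xs = (\<Sum>b<length xs. (ys ! b) (xs ! b))"
  by (simp add: tuple_eval_def sum_list_sum_nth atLeast0LessThan)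

definition block_functional :: "nat \<Rightarrow> (nat \<Rightarrow> real) list \<Rightarrow> nat \<Rightarrow> real" where
  "block_functional m ys i = (ys ! (i div m)) (i mod m + 1)"

lemma block_functional_block_var:
  "k \<in> {1..m} \<Longrightarrow> block_functional m ys (block_var m b k) = (ys ! b) k"
  using block_var_div_mod[of k m b] by (simp add: block_functional_def)

lemma sum_block_functional:
  assumes "length ys = d"
  shows "(\<Sum>i<d * m. block_functional m ys i) = (\<Sum>y\<leftarrow>ys. \<Sum>k=1..m. y k)"
proof -
  have "(\<Sum>i<d * m. block_functional m ys i) = (\<Sum>b<d. \<Sum>k=1..m. (ys ! b) k)"
    unfolding sum_block_var by (intro sum.cong refl block_functional_block_var)
  then show ?thesis using assms by (simp add: sum_list_sum_nth atLeast0LessThan)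
qed

lemma block_functional_tuple_exponent:
  assumes "set xs \<subseteq> {1..m}" "length xs = d" "length ys = d"
  shows "(\<Sum>i<d * m. block_functional m ys i * real (lookup (tuple_exponent m xs) i))
      = tuple_eval ys xs"
proof -
  have "xs ! b \<in> {1..m}" if "b < d" for b using assms that nth_mem by blast
  then show ?thesis
    using assms by (simp add: sum_tuple_exponent tuple_eval_eq_sum block_functional_block_var)
qed

subsection \<open>Convex combinations of block weights\<close>

lemma lookup_eps:
  "lookup (eps m b i) (c, k) = (if c = b then of_bool (k = i) - of_bool (k \<in> {1..m}) / real m else 0)"
proof -
  have "lookup (\<Sum>k=1..m. single (b, k) (1 / real m)) (c, k)
      = (\<Sum>l=1..m. if l = k then of_bool (c = b) / real m else 0)"
    unfolding lookup_sum by (intro sum.cong) (auto simp: lookup_single when_def)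
  also have "\<dots> = of_bool (c = b \<and> k \<in> {1..m}) / real m" by simp
  finally show ?thesis by (auto simp: eps_def lookup_minus lookup_single when_def)
qed

lemma lookup_eps_tuple:
  assumes xs: "set xs \<subseteq> {1..m}"
  shows "lookup (eps_tuple m xs) (b, k)
     = (if b < length xs \<and> k \<in> {1..m} then of_bool (xs ! b = k) - 1 / real m else 0)"
proof -
  have "lookup (eps_tuple m xs) (b, k)
      = (\<Sum>c<length xs. if c = b then of_bool (k = xs ! b) - of_bool (k \<in> {1..m}) / real m else 0)"
    unfolding eps_tuple_def lookup_sum by (intro sum.cong) (auto simp: lookup_eps)
  also have "\<dots> = (if b < length xs then of_bool (k = xs ! b) - of_bool (k \<in> {1..m}) / real m else 0)"
    by simp
  also have "\<dots> = (if b < length xs \<and> k \<in> {1..m} then of_bool (xs ! b = k) - 1 / real m else 0)"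
  proof (cases "b < length xs")
    case True
    then have "xs ! b \<in> {1..m}" using xs nth_mem by blast
    then show ?thesis by auto
  qed simp
  finally show ?thesis .
qed

lemma convex_hull_image_finite:
  fixes f :: "'i \<Rightarrow> 'a::real_vector"
  assumes "finite I"
  shows "convex hull (f ` I) = {\<Sum>i\<in>I. u i *\<^sub>R f i | u. (\<forall>i\<in>I. 0 \<le> u i) \<and> sum u I = 1}" (is "_ = ?C")
proof
  show "convex hull (f ` I) \<subseteq> ?C"
  proof (rule hull_minimal)
    show "f ` I \<subseteq> ?C"
    proof
      fix x assume "x \<in> f ` I"
      then obtain j where j: "j \<in> I" "x = f j" by blast
      have "(\<Sum>i\<in>I. (if i = j then 1 else 0) *\<^sub>R f i) = (\<Sum>i\<in>I. if i = j then f j else 0)"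
        by (intro sum.cong) auto
      then show "x \<in> ?C" using j assms
        by (intro CollectI exI[of _ "\<lambda>i. if i = j then 1 else (0::real)"]) simp
    qed
    show "convex ?C"
    proof (rule convexI)
      fix x y s t assume "x \<in> ?C" "y \<in> ?C" and st: "0 \<le> s" "0 \<le> (t::real)" "s + t = 1"
      then obtain u v where u: "x = (\<Sum>i\<in>I. u i *\<^sub>R f i)" "\<forall>i\<in>I. 0 \<le> u i" "sum u I = 1"
        and v: "y = (\<Sum>i\<in>I. v i *\<^sub>R f i)" "\<forall>i\<in>I. 0 \<le> v i" "sum v I = 1"
        by blast
      have "s *\<^sub>R x + t *\<^sub>R y = (\<Sum>i\<in>I. (s * u i + t * v i) *\<^sub>R f i)"
        by (simp add: u v scaleR_sum_right sum.distrib scaleR_add_left)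
      moreover have "(\<Sum>i\<in>I. s * u i + t * v i) = 1"
        using u v st by (simp add: sum.distrib flip: sum_distrib_left)
      ultimately show "s *\<^sub>R x + t *\<^sub>R y \<in> ?C"
        using u v st by (intro CollectI exI[of _ "\<lambda>i. s * u i + t * v i"]) auto
    qed
  qed
  show "?C \<subseteq> convex hull (f ` I)"
  proof
    fix x assume "x \<in> ?C"
    then obtain u where u: "x = (\<Sum>i\<in>I. u i *\<^sub>R f i)" "\<forall>i\<in>I. 0 \<le> u i" "sum u I = 1" by blast
    show "x \<in> convex hull (f ` I)"
      unfolding u(1)
      by (intro convex_sum assms convex_convex_hull u(3) u(2)[rule_format] hull_inc) auto
  qed
qed

locale block_tuples =
  fixes d m :: nat and I :: "'i set" and t :: "'i \<Rightarrow> nat list"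
  assumes d_pos: "d > 0" and m_pos: "m > 0" and finite_index: "finite I"
    and length_tuple: "w \<in> I \<Longrightarrow> length (t w) = d"
    and set_tuple: "w \<in> I \<Longrightarrow> set (t w) \<subseteq> {1..m}"
begin

definition marginal :: "('i \<Rightarrow> real) \<Rightarrow> nat \<Rightarrow> nat \<Rightarrow> real" where
  "marginal lam b k = (\<Sum>w\<in>I. lam w * of_bool (t w ! b = k))"

definition deviation :: "('i \<Rightarrow> real) \<Rightarrow> real" where
  "deviation lam = sqrt (\<Sum>b<d. \<Sum>k=1..m. (marginal lam b k - 1 / real m)\<^sup>2)"

lemma L2_set_combination:
  assumes "sum lam I = 1" and x: "x = (\<Sum>w\<in>I. lam w *\<^sub>R eps_tuple m (t w))"
  shows "L2_set (lookup x) (keys x) = deviation lam"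
proof -
  have lookup_x: "lookup x (b, k) = (if b < d \<and> k \<in> {1..m} then marginal lam b k - 1 / real m else 0)"
    for b k
  proof (cases "b < d \<and> k \<in> {1..m}")
    case True
    then have "lookup x (b, k) = (\<Sum>w\<in>I. lam w * (of_bool (t w ! b = k) - 1 / real m))"
      unfolding x lookup_sum using length_tuple set_tuple
      by (intro sum.cong refl) (simp add: lookup_scaleR lookup_eps_tuple)
    also have "\<dots> = marginal lam b k - sum lam I / real m"
      by (simp add: marginal_def right_diff_distrib sum_subtractf sum_divide_distrib)
    finally show ?thesis using True assms(1) by simp
  next
    case False
    then have "lookup x (b, k) = (\<Sum>w\<in>I. 0)"
      unfolding x lookup_sum using length_tuple set_tuple
      by (intro sum.cong refl) (auto simp: lookup_scaleR lookup_eps_tuple)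
    then show ?thesis using False by auto
  qed
  have "(\<Sum>z\<in>keys x. (lookup x z)\<^sup>2) = (\<Sum>z\<in>{..<d} \<times> {1..m}. (lookup x z)\<^sup>2)"
    using lookup_x by (intro sum.mono_neutral_left) (auto simp: in_keys_iff split: if_splits)
  also have "\<dots> = (\<Sum>b<d. \<Sum>k=1..m. (marginal lam b k - 1 / real m)\<^sup>2)"
    unfolding sum.cartesian_product' by (intro sum.cong refl) (auto simp: lookup_x)
  finally show ?thesis by (simp add: L2_set_def deviation_def)
qed

lemma euclid_dist_0_hull_le_deviation:
  assumes "\<And>w. w \<in> I \<Longrightarrow> lam w \<ge> 0" and lam1: "sum lam I = 1"
  shows "euclid_dist_0 (convex hull ((\<lambda>w. eps_tuple m (t w)) ` I)) \<le> deviation lam"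
proof -
  define x where "x = (\<Sum>w\<in>I. lam w *\<^sub>R eps_tuple m (t w))"
  have "x \<in> convex hull ((\<lambda>w. eps_tuple m (t w)) ` I)"
    unfolding convex_hull_image_finite[OF finite_index] x_def using assms by blast
  then have "euclid_dist_0 (convex hull ((\<lambda>w. eps_tuple m (t w)) ` I)) \<le> L2_set (lookup x) (keys x)"
    unfolding euclid_dist_0_def by (intro cINF_lower bdd_belowI[of _ 0]) auto
  then show ?thesis by (simp add: L2_set_combination[OF lam1 x_def])
qed

end

locale free_block_tuples = block_tuples +
  assumes far: "w \<in> I \<Longrightarrow> w' \<in> I \<Longrightarrow> w \<noteq> w' \<Longrightarrow> 2 \<le> hamming_distance (t w) (t w')"
begin

lemma tuple_exponent_add_single_eqD:
  assumes "w \<in> I" "w' \<in> I" "tuple_exponent m (t w) + single i 1 = tuple_exponent m (t w') + single j 1"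
  shows "w = w'"
proof (rule ccontr)
  assume "w \<noteq> w'"
  with assms(1,2) have "tuple_exponent m (t w) + single i 1 \<noteq> tuple_exponent m (t w') + single j 1"
    by (intro tuple_exponent_free set_tuple far) (simp_all add: length_tuple)
  with assms(3) show False by contradiction
qed

lemma inj_on_tuple_exponent: "inj_on (\<lambda>w. tuple_exponent m (t w)) I"
  by (rule inj_onI) (rule tuple_exponent_add_single_eqD[where i = 0 and j = 0], auto)

lemma free_exponents_tuples: "free_exponents (d * m) ((\<lambda>w. tuple_exponent m (t w)) ` I)"
  unfolding free_exponents_def by (intro ballI allI impI) (auto dest: tuple_exponent_add_single_eqD)

lemma gap_le_deviation:
  assumes inv: "SU_invariant_inner (d * m) d ip"
    and ys: "length ys = d" "(\<Sum>y\<leftarrow>ys. \<Sum>k=1..m. y k) = 0" "\<And>w. w \<in> I \<Longrightarrow> tuple_eval ys (t w) > 0"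
    and lam: "\<And>w. w \<in> I \<Longrightarrow> lam w \<ge> 0" and lam1: "sum lam I = 1"
  shows "gap (d * m) d ip \<le> deviation lam"
proof -
  interpret SU_invariant_inner_product "d * m" d ip by unfold_locales (rule inv)
  let ?a = "\<lambda>w. tuple_exponent m (t w)"
  define lam' where "lam' = lam \<circ> the_inv_into I ?a"
  have lam': "lam' (?a w) = lam w" if "w \<in> I" for w
    using the_inv_into_f_f[OF inj_on_tuple_exponent that] by (simp add: lam'_def)
  have sum_lam': "(\<Sum>e\<in>?a ` I. lam' e * f e) = (\<Sum>w\<in>I. lam w * f (?a w))" for f
    using lam' by (simp add: sum.reindex[OF inj_on_tuple_exponent])
  have "gap (d * m) d ip
      \<le> sqrt (\<Sum>i<d * m. ((\<Sum>e\<in>?a ` I. lam' e * real (lookup e i)) - real d / real (d * m))\<^sup>2)"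
  proof (rule gap_le_free_exponents[where y = "block_functional m ys"])
    show "?a ` I \<subseteq> exponents (d * m) d"
      using tuple_exponent_in_exponents set_tuple length_tuple by auto
    show "(\<Sum>i<d * m. block_functional m ys i) = 0" using sum_block_functional ys(1,2) by simp
    show "(\<Sum>i<d * m. block_functional m ys i * real (lookup e i)) > 0" if "e \<in> ?a ` I" for e
      using that ys(1,3) set_tuple length_tuple block_functional_tuple_exponent by auto
    show "lam' e \<ge> 0" if "e \<in> ?a ` I" for e using that lam lam' by auto
    show "sum lam' (?a ` I) = 1" using sum_lam'[of "\<lambda>_. 1"] lam1 by simp
  qed (use finite_index d_pos m_pos free_exponents_tuples in auto)
  also have "(\<Sum>i<d * m. ((\<Sum>e\<in>?a ` I. lam' e * real (lookup e i)) - real d / real (d * m))\<^sup>2)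
     = (\<Sum>b<d. \<Sum>k=1..m. (marginal lam b k - 1 / real m)\<^sup>2)"
    unfolding sum_block_var
  proof (intro sum.cong refl)
    fix b k assume bk: "b \<in> {..<d}" "k \<in> {1..m}"
    have "(\<Sum>e\<in>?a ` I. lam' e * real (lookup e (block_var m b k))) = marginal lam b k"
      unfolding sum_lam' marginal_def using bk set_tuple length_tuple
      by (intro sum.cong refl) (simp add: lookup_tuple_exponent)
    then show "((\<Sum>e\<in>?a ` I. lam' e * real (lookup e (block_var m b k))) - real d / real (d * m))\<^sup>2
       = (marginal lam b k - 1 / real m)\<^sup>2"
      using d_pos by simp
  qed
  finally show ?thesis by (simp add: deviation_def)
qed

lemma gap_le_euclid_dist_0_hull:
  assumes "I \<noteq> {}" and inv: "SU_invariant_inner (d * m) d ip"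
    and ys: "length ys = d" "(\<Sum>y\<leftarrow>ys. \<Sum>k=1..m. y k) = 0" "\<And>w. w \<in> I \<Longrightarrow> tuple_eval ys (t w) > 0"
  shows "gap (d * m) d ip \<le> euclid_dist_0 (convex hull ((\<lambda>w. eps_tuple m (t w)) ` I))"
  unfolding euclid_dist_0_def
proof (rule cINF_greatest)
  show "convex hull ((\<lambda>w. eps_tuple m (t w)) ` I) \<noteq> {}" using assms(1) by simp
  fix x assume "x \<in> convex hull ((\<lambda>w. eps_tuple m (t w)) ` I)"
  then obtain lam where x: "x = (\<Sum>w\<in>I. lam w *\<^sub>R eps_tuple m (t w))"
    and lam: "\<forall>w\<in>I. 0 \<le> lam w" "sum lam I = 1"
    unfolding convex_hull_image_finite[OF finite_index] by blast
  have "gap (d * m) d ip \<le> deviation lam"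
    by (rule gap_le_deviation[OF inv ys]) (use lam in auto)
  then show "gap (d * m) d ip \<le> L2_set (lookup x) (keys x)"
    by (simp add: L2_set_combination[OF lam(2) x])
qed

end

subsection \<open>The index maps\<close>

definition cyclic_block :: "nat \<Rightarrow> nat \<Rightarrow> nat \<Rightarrow> nat" where
  "cyclic_block r m u = (u div r) mod m + 1"

lemma ceiling_Suc_divide:
  assumes "r \<ge> 1"
  shows "\<lceil>(real u + 1) / real r\<rceil> = int (u div r) + 1"
proof (rule ceiling_unique)
  have "real u = real (r * (u div r) + u mod r)" by simp
  then have u: "real u = real r * real (u div r) + real (u mod r)"
    by (simp only: of_nat_add of_nat_mult)
  have "real (u mod r) + 1 \<le> real r"
    using assms mod_less_divisor[of r u] by linarith
  then show "(real u + 1) / real r \<le> real_of_int (int (u div r) + 1)"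
    using assms unfolding u by (simp add: field_simps)
  show "real_of_int (int (u div r) + 1) - 1 < (real u + 1) / real r"
    using assms unfolding u by (simp add: field_simps)
qed

lemma sigma_low_eq_cyclic_block:
  assumes "i \<ge> 1" "j \<ge> 1" "r \<ge> 1" "m \<ge> 1"
  shows "sigma_low r m i j = cyclic_block r m (j + i - 2)"
proof -
  define u where "u = j + i - 2"
  have u: "real j + real i - 1 = real u + 1" using assms by (simp add: u_def)
  have "sigma_low r m i j = mod' (Suc (u div r)) m"
    unfolding sigma_low_def u ceiling_Suc_divide[OF assms(3)] by (simp add: nat_add_distrib)
  then show ?thesis using assms by (simp add: mod'_def mod_Suc cyclic_block_def u_def)
qed

lemma sigma_eq_cyclic_block:
  assumes "1 \<le> l" "l \<le> r" "m \<ge> 1" "j \<ge> 1"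
  shows "sigma r m l j = cyclic_block r m (j + l - 2)"
  using assms by (simp add: sigma_def sigma_low_eq_cyclic_block)

lemma sigma_eq_cyclic_block_transpose:
  assumes "1 \<le> p" "p \<le> r" "m \<ge> 1" "j \<ge> 1"
  shows "sigma r m (Suc (2 * r) - p) j = cyclic_block r m (Transposition.transpose p (r + 1) j - 1)"
proof -
  have "r - (Suc (2 * r) - p - r) + 1 = p" using assms by simp
  moreover have "Transposition.transpose p (r + 1) j \<ge> 1"
    using assms by (auto simp: Transposition.transpose_def)
  ultimately show ?thesis using assms by (simp add: sigma_def sigma_low_eq_cyclic_block)
qed

lemma sigma_cases:
  fixes l r :: nat
  assumes "l \<in> {1..<2 * r}"
  obtains "1 \<le> l" "l \<le> r" | p where "2 \<le> p" "p \<le> r" "l = Suc (2 * r) - p"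
proof (cases "l \<le> r")
  case False
  then show ?thesis using assms that(2)[of "Suc (2 * r) - l"] by auto
qed (use assms that(1) in auto)

lemma sigma_range:
  assumes "l \<in> {1..<2 * r}" "m \<ge> 1" "j \<ge> 1"
  shows "sigma r m l j \<in> {1..m}"
proof -
  have "cyclic_block r m u \<in> {1..m}" for u
    using assms(2) by (simp add: cyclic_block_def Suc_le_eq)
  then show ?thesis
    using assms
    by (cases rule: sigma_cases[OF assms(1)])
       (auto simp: sigma_eq_cyclic_block sigma_eq_cyclic_block_transpose)
qed

lemma sum_periodic_shift:
  fixes g :: "nat \<Rightarrow> 'a::ab_group_add"
  assumes "\<And>u. g (u + N) = g u"
  shows "(\<Sum>u<N. g (u + c)) = (\<Sum>u<N. g u)"
proof (induction c)
  case (Suc c)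
  have "g c + (\<Sum>u<N. g (u + Suc c)) = (\<Sum>u<Suc N. g (u + c))"
    by (subst sum.lessThan_Suc_shift) simp
  also have "\<dots> = g c + (\<Sum>u<N. g (u + c))" using assms[of c] by (simp add: add.commute)
  finally show ?case using Suc by simp
qed simp

lemma sum_cyclic_block:
  fixes f :: "nat \<Rightarrow> real"
  assumes r: "r \<ge> 1"
  shows "(\<Sum>j=1..r * m. f (cyclic_block r m (j + c - 1))) = real r * (\<Sum>k=1..m. f k)"
proof -
  have "(\<Sum>j=1..r * m. f (cyclic_block r m (j + c - 1))) = (\<Sum>u<r * m. f (cyclic_block r m (u + c)))"
    by (simp add: sum.atLeast1_atMost_eq)
  also have "\<dots> = (\<Sum>u<m * r. f (cyclic_block r m u))"
    using r by (subst sum_periodic_shift) (simp_all add: cyclic_block_def mult.commute)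
  also have "\<dots> = (\<Sum>b<m. \<Sum>k=1..r. f (Suc b))"
    unfolding sum_block_var by (intro sum.cong refl) (simp add: cyclic_block_def block_var_div_mod)
  also have "\<dots> = real r * (\<Sum>k=1..m. f k)"
    by (simp add: sum.atLeast1_atMost_eq sum_distrib_left)
  finally show ?thesis .
qed

lemma add_one_le_mult: "r \<ge> 1 \<Longrightarrow> m \<ge> 2 \<Longrightarrow> r + 1 \<le> r * m" for r m :: nat
  using mult_le_mono2[of 2 m r] by linarith

lemma sum_sigma:
  fixes f :: "nat \<Rightarrow> real"
  assumes l: "l \<in> {1..<2 * r}" and m: "m \<ge> 2"
  shows "(\<Sum>j=1..r * m. f (sigma r m l j)) = real r * (\<Sum>k=1..m. f k)"
  using l
proof (cases rule: sigma_cases)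
  case 1
  then have "(\<Sum>j=1..r * m. f (sigma r m l j)) = (\<Sum>j=1..r * m. f (cyclic_block r m (j + (l - 1) - 1)))"
    using m by (intro sum.cong refl) (auto simp: sigma_eq_cyclic_block numeral_2_eq_2)
  then show ?thesis using sum_cyclic_block[of r f m "l - 1"] 1 by simp
next
  case (2 p)
  let ?\<tau> = "Transposition.transpose p (r + 1)"
  have "r + 1 \<le> r * m" using add_one_le_mult[of r m] 2 m by simp
  then have \<tau>: "?\<tau> j \<in> {1..r * m}" if "j \<in> {1..r * m}" for j
    using that 2 by (auto simp: Transposition.transpose_def)
  have "(\<Sum>j=1..r * m. f (sigma r m l j)) = (\<Sum>j=1..r * m. f (cyclic_block r m (?\<tau> j - 1)))"
    using 2 m by (intro sum.cong refl) (auto simp: sigma_eq_cyclic_block_transpose)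
  also have "\<dots> = (\<Sum>j=1..r * m. f (cyclic_block r m (j - 1)))"
    by (rule sum.reindex_bij_witness[of _ ?\<tau> ?\<tau>]) (use \<tau> in auto)
  finally show ?thesis using sum_cyclic_block[of r f m 0] 2 by simp
qed

subsection \<open>The index maps determine all functions\<close>

lemma sum_indicator_points:
  fixes U :: "'a \<Rightarrow> real"
  assumes "finite A"
  shows "(\<Sum>a\<in>A. U a * indicator {a} j) = U j * indicator A j"
proof -
  have "(\<Sum>a\<in>A. U a * indicator {a} j) = (\<Sum>a\<in>A. if j = a then U a else 0)"
    by (intro sum.cong) (auto simp: indicator_def)
  then show ?thesis using assms by (simp add: indicator_def)
qed

definition sigma_span :: "nat \<Rightarrow> nat \<Rightarrow> (nat \<Rightarrow> real) set" where
  "sigma_span r m = {U. \<exists>y. \<forall>j\<in>{1..r * m}. U j = (\<Sum>l\<in>{1..<2 * r}. y l (sigma r m l j))}"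

lemma sigma_span_cong:
  assumes "U \<in> sigma_span r m" "\<And>j. j \<in> {1..r * m} \<Longrightarrow> V j = U j"
  shows "V \<in> sigma_span r m"
  using assms by (auto simp: sigma_span_def)

lemma sigma_span_add:
  assumes "U \<in> sigma_span r m" "V \<in> sigma_span r m"
  shows "(\<lambda>j. U j + V j) \<in> sigma_span r m"
proof -
  obtain y z where "\<forall>j\<in>{1..r * m}. U j = (\<Sum>l\<in>{1..<2 * r}. y l (sigma r m l j))"
    "\<forall>j\<in>{1..r * m}. V j = (\<Sum>l\<in>{1..<2 * r}. z l (sigma r m l j))"
    using assms unfolding sigma_span_def by blast
  then show ?thesis unfolding sigma_span_def
    by (intro CollectI exI[of _ "\<lambda>l k. y l k + z l k"]) (simp add: sum.distrib)
qed

lemma sigma_span_scale: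
  assumes "U \<in> sigma_span r m"
  shows "(\<lambda>j. c * U j) \<in> sigma_span r m"
proof -
  obtain y where "\<forall>j\<in>{1..r * m}. U j = (\<Sum>l\<in>{1..<2 * r}. y l (sigma r m l j))"
    using assms unfolding sigma_span_def by blast
  then show ?thesis unfolding sigma_span_def
    by (intro CollectI exI[of _ "\<lambda>l k. c * y l k"]) (simp add: sum_distrib_left)
qed

lemma sigma_span_diff:
  assumes "U \<in> sigma_span r m" "V \<in> sigma_span r m"
  shows "(\<lambda>j. U j - V j) \<in> sigma_span r m"
  using sigma_span_add[OF assms(1) sigma_span_scale[OF assms(2), of "-1"]] by simp

lemma sigma_span_sum:
  assumes "\<And>x. x \<in> X \<Longrightarrow> F x \<in> sigma_span r m"
  shows "(\<lambda>j. \<Sum>x\<in>X. F x j) \<in> sigma_span r m"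
  using assms
proof (induction X rule: infinite_finite_induct)
  case (insert x X)
  then show ?case using sigma_span_add[of "F x" r m "\<lambda>j. \<Sum>x\<in>X. F x j"] by simp
qed (auto simp: sigma_span_def intro!: exI[of _ "\<lambda>_ _. 0"])

lemma sigma_span_fibre:
  assumes "l \<in> {1..<2 * r}"
  shows "indicator {j. sigma r m l j = k} \<in> sigma_span r m"
  unfolding sigma_span_def
proof (intro CollectI exI[of _ "\<lambda>l' k'. if l' = l then indicator {k} k' else 0"] ballI)
  fix j
  show "indicator {j. sigma r m l j = k} j
      = (\<Sum>l'\<in>{1..<2 * r}. if l' = l then indicator {k} (sigma r m l' j) else (0::real))"
    using assms by (simp add: indicator_def)
qed

lemma sigma_eq_iff_window:
  assumes l: "1 \<le> l" "l \<le> r" and k: "k < m" "l \<le> k * r + 1" and j: "j \<in> {1..r * m}"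
  shows "sigma r m l j = k + 1 \<longleftrightarrow> k * r + 2 \<le> j + l \<and> j + l < k * r + 2 + r"
proof -
  let ?q = "(j + l - 2) div r"
  have r: "r > 0" using l by simp
  have "?q \<noteq> m" if "k = 0"
  proof -
    have "l = 1" using that k(2) l(1) by simp
    then have "?q < m" using j r by (auto simp: div_less_iff_less_mult mult.commute)
    then show ?thesis by simp
  qed
  moreover have "?q \<le> m"
  proof -
    have "j + l - 2 < Suc m * r" using j l by (auto simp: mult.commute)
    then have "?q < Suc m" by (simp only: div_less_iff_less_mult[OF r])
    then show ?thesis by simp
  qed
  ultimately have "?q mod m = k \<longleftrightarrow> ?q = k"
    using k(1) by (cases "?q = m") auto
  moreover have "?q = k \<longleftrightarrow> k * r \<le> j + l - 2 \<and> j + l - 2 < k * r + r"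
    using less_eq_div_iff_mult_less_eq[OF r, of k "j + l - 2"]
      div_less_iff_less_mult[OF r, of "j + l - 2" "Suc k"]
    by auto
  moreover have "sigma r m l j = ?q mod m + 1"
    using l j k(1) by (subst sigma_eq_cyclic_block) (auto simp: cyclic_block_def)
  ultimately have "sigma r m l j = k + 1 \<longleftrightarrow> k * r \<le> j + l - 2 \<and> j + l - 2 < k * r + r"
    by simp
  moreover have "j \<ge> 1" using j by simp
  ultimately show ?thesis using l(1) by linarith
qed

lemma sigma_span_window:
  assumes r: "r \<ge> 1" and a: "1 \<le> a" "a + r \<le> r * m + 1"
  shows "indicator {a..<a + r} \<in> sigma_span r m"
proof -
  define k where "k = (a - 1 + (r - 1)) div r"
  have k: "a - 1 \<le> k * r" "k * r < a - 1 + r"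
  proof -
    have "a - 1 + (r - 1) = k * r + (a - 1 + (r - 1)) mod r" unfolding k_def by simp
    moreover have "(a - 1 + (r - 1)) mod r \<le> r - 1"
      using r mod_less_divisor[of r "a - 1 + (r - 1)"] by linarith
    ultimately show "a - 1 \<le> k * r" "k * r < a - 1 + r" using r by linarith+
  qed
  have "k * r < r * m" using k a by linarith
  then have k_less_m: "k < m" by (simp add: mult.commute)
  define l where "l = k * r + 2 - a"
  have l: "1 \<le> l" "l \<le> r" "l \<le> k * r + 1" "l + a = k * r + 2" using k a r by (auto simp: l_def)
  have "indicator {j. sigma r m l j = k + 1} \<in> sigma_span r m"
    using l r by (intro sigma_span_fibre) auto
  then show ?thesis
  proof (rule sigma_span_cong)
    fix j assume "j \<in> {1..r * m}"
    then have "sigma r m l j = k + 1 \<longleftrightarrow> j \<in> {a..<a + r}"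
      using sigma_eq_iff_window[OF l(1,2) k_less_m l(3)] l(4) by auto
    then show "indicator {a..<a + r} j = (indicator {j. sigma r m l j = k + 1} j :: real)"
      by (simp add: indicator_def)
  qed
qed

lemma sigma_span_shift:
  assumes "r \<ge> 1" "1 \<le> a" "a + r \<le> r * m"
  shows "(\<lambda>j. indicator {a + r} j - indicator {a} j) \<in> sigma_span r m"
proof -
  have "(\<lambda>j. indicator {a + 1..<a + 1 + r} j - indicator {a..<a + r} j) \<in> sigma_span r m"
    using assms by (intro sigma_span_diff sigma_span_window) auto
  then show ?thesis
    by (rule sigma_span_cong) (use assms in \<open>auto simp: indicator_def\<close>)
qed

lemma sigma_span_transpose:
  assumes p: "2 \<le> p" "p \<le> r" and m: "m \<ge> 2"
  shows "(\<lambda>j. indicator {r + 1} j - indicator {p} j) \<in> sigma_span r m"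
proof -
  have rm: "r + 1 \<le> r * m" using add_one_le_mult[of r m] p m by simp
  have "(\<lambda>j. indicator {j. sigma r m (Suc (2 * r) - p) j = 1} j - indicator {1..<1 + r} j)
      \<in> sigma_span r m"
    using p rm m by (intro sigma_span_diff sigma_span_fibre sigma_span_window) auto
  then show ?thesis
  proof (rule sigma_span_cong)
    fix j assume j: "j \<in> {1..r * m}"
    let ?\<tau> = "Transposition.transpose p (r + 1)"
    have \<tau>: "1 \<le> ?\<tau> j" "?\<tau> j \<le> r * m" using j p rm by (auto simp: Transposition.transpose_def)
    then have "(?\<tau> j - 1) div r < m" using p by (simp add: div_less_iff_less_mult mult.commute)
    then have "sigma r m (Suc (2 * r) - p) j = 1 \<longleftrightarrow> ?\<tau> j \<le> r"
      using j p m \<tau> by (auto simp: sigma_eq_cyclic_block_transpose cyclic_block_def div_eq_0_iff)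
    then show "indicator {r + 1} j - indicator {p} j
        = (indicator {j. sigma r m (Suc (2 * r) - p) j = 1} j - indicator {1..<1 + r} j :: real)"
      using j p by (auto simp: indicator_def Transposition.transpose_def)
  qed
qed

lemma sigma_span_point_diff:
  assumes r: "r \<ge> 1" and m: "m \<ge> 2" and a: "1 \<le> a" "a \<le> r * m"
  shows "(\<lambda>j. indicator {a} j - indicator {1} j) \<in> sigma_span r m"
  using a
proof (induction a rule: less_induct)
  case (less a)
  have rm: "r + 1 \<le> r * m" using add_one_le_mult[OF r m] .
  consider "a = 1" | "2 \<le> a" "a \<le> r" | "r < a" using less.prems by linarith
  then show ?case
  proof cases
    case 1
    then show ?thesis using sigma_span_sum[of "{}"] by simp
  next
    case 2
    have "(\<lambda>j. (indicator {1 + r} j - indicator {1} j) - (indicator {r + 1} j - indicator {a} j))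
        \<in> sigma_span r m"
      using 2 r rm by (intro sigma_span_diff[OF sigma_span_shift sigma_span_transpose] m) auto
    then show ?thesis by simp
  next
    case 3
    then have "(\<lambda>j. (indicator {a - r + r} j - indicator {a - r} j) + (indicator {a - r} j - indicator {1} j))
        \<in> sigma_span r m"
      using less.prems r by (intro sigma_span_add[OF sigma_span_shift less.IH]) auto
    then show ?thesis using 3 by simp
  qed
qed

text \<open>The window \<open>1, \<dots>, r\<close> is congruent to \<open>r\<close> times any point modulo the differences of points.\<close>

lemma sigma_span_point:
  assumes r: "r \<ge> 1" and m: "m \<ge> 2" and a: "1 \<le> a" "a \<le> r * m"
  shows "indicator {a} \<in> sigma_span r m"
proof -
  have rm: "r + 1 \<le> r * m" using add_one_le_mult[OF r m] .
  have window: "(\<Sum>b=1..r. indicator {b} j) = (indicator {1..<1 + r} j :: real)" for j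
    using sum_indicator_points[of "{1..r}" "\<lambda>_. 1" j] by (simp add: atLeastLessThanSuc_atLeastAtMost)
  have diffs: "(\<lambda>j. \<Sum>b=1..r. indicator {b} j - indicator {1} j) \<in> sigma_span r m"
    using rm by (intro sigma_span_sum sigma_span_point_diff r m) auto
  have "(\<lambda>j. (1 / real r) * (indicator {1..<1 + r} j - (\<Sum>b=1..r. indicator {b} j - indicator {1} j)) +
      (indicator {a} j - indicator {1} j)) \<in> sigma_span r m"
    using rm m
    by (intro sigma_span_add[OF sigma_span_scale[OF sigma_span_diff[OF sigma_span_window diffs]]]
          sigma_span_point_diff r m a) auto
  then show ?thesis
    by (rule sigma_span_cong) (unfold sum_subtractf window, use r in simp)
qed

lemma sigma_span_UNIV:
  assumes r: "r \<ge> 1" and m: "m \<ge> 2"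
  shows "U \<in> sigma_span r m"
proof (rule sigma_span_cong)
  show "(\<lambda>j. \<Sum>a=1..r * m. U a * indicator {a} j) \<in> sigma_span r m"
    by (intro sigma_span_sum sigma_span_scale sigma_span_point r m) auto
  show "U j = (\<Sum>a=1..r * m. U a * indicator {a} j)" if "j \<in> {1..r * m}" for j
    using sum_indicator_points[of "{1..r * m}" U j] that by simp
qed

lemma length_sigma_list [simp]: "length (sigma_list r m j) = 2 * r - 1"
  by (simp add: sigma_list_def)

lemma sigma_list_represents:
  fixes U :: "nat \<Rightarrow> real"
  assumes r: "r \<ge> 1" and m: "m \<ge> 2"
  obtains ys where "length ys = 2 * r - 1"
    and "\<And>j. j \<in> {1..r * m} \<Longrightarrow> tuple_eval ys (sigma_list r m j) = U j"
    and "real r * (\<Sum>y\<leftarrow>ys. \<Sum>k=1..m. y k) = (\<Sum>j=1..r * m. U j)"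
proof -
  obtain y where y: "\<And>j. j \<in> {1..r * m} \<Longrightarrow> U j = (\<Sum>l\<in>{1..<2 * r}. y l (sigma r m l j))"
    using sigma_span_UNIV[OF assms, of U] unfolding sigma_span_def by blast
  have "(\<Sum>j=1..r * m. U j) = (\<Sum>j=1..r * m. \<Sum>l\<in>{1..<2 * r}. y l (sigma r m l j))"
    by (intro sum.cong refl y)
  also have "\<dots> = (\<Sum>l\<in>{1..<2 * r}. \<Sum>j=1..r * m. y l (sigma r m l j))"
    by (rule sum.swap)
  also have "\<dots> = (\<Sum>l\<in>{1..<2 * r}. real r * (\<Sum>k=1..m. y l k))"
    using m by (intro sum.cong refl sum_sigma) auto
  finally have "real r * (\<Sum>y\<leftarrow>map y [1..<2 * r]. \<Sum>k=1..m. y k) = (\<Sum>j=1..r * m. U j)"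
    by (simp add: sum_distrib_left o_def interv_sum_list_conv_sum_set_nat)
  moreover have "tuple_eval (map y [1..<2 * r]) (sigma_list r m j) = U j" if "j \<in> {1..r * m}" for j
    unfolding sigma_list_def tuple_eval_map y[OF that] by (simp add: interv_sum_list_conv_sum_set_nat)
  ultimately show thesis by (intro that[of "map y [1..<2 * r]"]) auto
qed

lemma inj_on_sigma_list:
  assumes "r \<ge> 1" "m \<ge> 2"
  shows "inj_on (sigma_list r m) {1..r * m}"
proof (rule inj_onI)
  fix i j assume ij: "i \<in> {1..r * m}" "j \<in> {1..r * m}" "sigma_list r m i = sigma_list r m j"
  obtain ys where ys: "\<And>j. j \<in> {1..r * m} \<Longrightarrow> tuple_eval ys (sigma_list r m j) = real j"
    using sigma_list_represents[OF assms, of real] by metis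
  have "real i = real j" using ys[OF ij(1)] ys[OF ij(2)] unfolding ij(3) by simp
  then show "i = j" by simp
qed

subsection \<open>Weights on \<open>\<W>\<^sub>N\<close>\<close>

lemma finite_W_set: "finite (W_set N)"
  by (simp add: W_set_def)

lemma W_set_range: "(i, j, k) \<in> W_set N \<Longrightarrow> i \<in> {1..N} \<and> j \<in> {1..N} \<and> k \<in> {1..N}"
  by (auto simp: W_set_def)

lemma W_set_two_differences:
  assumes "(i, j, k) \<in> W_set N" "(i', j', k') \<in> W_set N" "(i, j, k) \<noteq> (i', j', k')"
  shows "(i \<noteq> i' \<and> j \<noteq> j') \<or> (i \<noteq> i' \<and> k \<noteq> k') \<or> (j \<noteq> j' \<and> k \<noteq> k')"
  using assms by (auto simp: W_set_def)

text \<open>The value \<open>1\<close> on all weights determines \<open>U\<close> from \<open>V\<close> and forces \<open>V\<close> to be halved at each step;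
  the initial value is then fixed by the vanishing of the total sum.\<close>

lemma W_set_functional:
  assumes N: "N \<ge> 2"
  obtains U V :: "nat \<Rightarrow> real"
  where "\<And>i j k. (i, j, k) \<in> W_set N \<Longrightarrow> U i + V j + V k = 1"
    and "(\<Sum>j=1..N. U j) + 2 * (\<Sum>j=1..N. V j) = 0"
proof -
  define V where "V s = (if s = 1 then 0 else real N * 2 ^ N / 2 ^ s)" for s :: nat
  define U where "U s = 1 - 2 * V (s + 1)" for s :: nat
  have half: "2 * V (s + 1) = V s" if "s \<ge> 2" for s
    using that by (simp add: V_def)
  have "U i + V j + V k = 1" if W: "(i, j, k) \<in> W_set N" for i j k
  proof -
    obtain s where s: "s \<in> {2..N}" "(i, j, k) \<in> {(s, 1, s), (s, s, 1), (s - 1, s, s)}"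
      using W unfolding W_set_def by blast
    then show ?thesis using half[of s] by (auto simp: U_def V_def[of "Suc 0"])
  qed
  moreover have "(\<Sum>j=1..n. U j) + 2 * (\<Sum>j=1..n. V j) = real n - real N * 2 ^ N / 2 ^ n"
    if "n \<ge> 1" for n
    using that
  proof (induction n rule: nat_induct_at_least)
    case base
    then show ?case by (simp add: U_def V_def)
  next
    case (Suc n)
    define c where "c = real N * 2 ^ N / 2 ^ Suc n"
    have "V (Suc n) = c" "U (Suc n) = 1 - c" "real N * 2 ^ N / 2 ^ n = 2 * c"
      using Suc.hyps by (simp_all add: U_def V_def c_def)
    then show ?case using Suc.IH unfolding c_def[symmetric] by simp
  qed
  from this[of N] N have "(\<Sum>j=1..N. U j) + 2 * (\<Sum>j=1..N. V j) = 0" by simp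
  ultimately show thesis by (rule that)
qed

lemma W_set_minus_J_set:
  assumes "r \<ge> 1"
  shows "W_set N - J_set r
    = (\<lambda>s. (s, 1, s)) ` {r+1..N} \<union> (\<lambda>s. (s, s, 1)) ` {r+1..N} \<union> (\<lambda>s. (s - 1, s, s)) ` {2..N}"
    (is "_ = ?R")
proof (intro equalityI subsetI)
  fix w assume "w \<in> W_set N - J_set r"
  then obtain s where s: "s \<in> {2..N}" "w = (s, 1, s) \<or> w = (s, s, 1) \<or> w = (s - 1, s, s)"
    and nJ: "w \<notin> J_set r" by (auto simp: W_set_def)
  have "s > r" if "w = (s, 1, s) \<or> w = (s, s, 1)"
    using nJ s that by (force simp: J_set_def not_le[symmetric])
  then show "w \<in> ?R" using s by auto
next
  fix w assume "w \<in> ?R"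
  then show "w \<in> W_set N - J_set r" using assms by (force simp: W_set_def J_set_def)
qed

lemma sum_W_set_minus_J_set:
  fixes G :: "nat \<times> nat \<times> nat \<Rightarrow> real"
  assumes r: "r \<ge> 1"
  shows "(\<Sum>w\<in>W_set N - J_set r. G w)
    = (\<Sum>s=r+1..N. G (s, 1, s)) + (\<Sum>s=r+1..N. G (s, s, 1)) + (\<Sum>s=2..N. G (s - 1, s, s))"
proof -
  let ?A = "(\<lambda>s::nat. (s, 1::nat, s)) ` {r+1..N}" and ?B = "(\<lambda>s::nat. (s, s, 1::nat)) ` {r+1..N}"
    and ?C = "(\<lambda>s::nat. (s - 1, s, s)) ` {2..N}"
  have "(\<Sum>w\<in>?A \<union> ?B \<union> ?C. G w) = sum G ?A + sum G ?B + sum G ?C"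
    using r by (subst sum.union_disjoint, auto)+
  moreover have "sum G ?A = (\<Sum>s=r+1..N. G (s, 1, s))" "sum G ?B = (\<Sum>s=r+1..N. G (s, s, 1))"
    "sum G ?C = (\<Sum>s=2..N. G (s - 1, s, s))"
    by (subst sum.reindex; auto simp: inj_on_def)+
  ultimately show ?thesis unfolding W_set_minus_J_set[OF r] by simp
qed

text \<open>The ratio \<open>2\<close> makes the first marginal telescope, and the value \<open>1 / N\<close> at \<open>N + 1\<close> makes it
  uniform at the upper end.\<close>

definition W_geometric :: "nat \<Rightarrow> nat \<Rightarrow> real" where
  "W_geometric N s = 2 ^ s / (2 * 2 ^ N * real N)"

definition W_weight :: "nat \<Rightarrow> nat \<Rightarrow> nat \<times> nat \<times> nat \<Rightarrow> real" where
  "W_weight r N = (\<lambda>(i, j, k). if j = 1 \<or> k = 1 then W_geometric N i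
     else 1 / real N - (if j \<le> r then 0 else W_geometric N j))"

lemma W_geometric_nonneg: "W_geometric N s \<ge> 0"
  by (simp add: W_geometric_def)

lemma W_geometric_le: "s \<le> N \<Longrightarrow> W_geometric N s \<le> 1 / real N"
proof -
  assume "s \<le> N"
  then have "(2::real) ^ s \<le> 2 ^ N" by (intro power_increasing) auto
  also have "\<dots> \<le> 2 * 2 ^ N" by simp
  finally have "(2::real) ^ s \<le> 2 * 2 ^ N" .
  then show ?thesis by (simp add: W_geometric_def divide_simps)
qed

lemma W_weight_nonneg:
  assumes "w \<in> W_set N"
  shows "W_weight r N w \<ge> 0"
proof -
  obtain i j k where w: "w = (i, j, k)" by (cases w)
  have "W_geometric N j \<le> 1 / real N"
    using W_set_range[of i j k N] assms w by (intro W_geometric_le) auto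
  then show ?thesis using W_geometric_nonneg by (auto simp: W_weight_def w)
qed

lemma sum_W_weight:
  fixes F :: "nat \<times> nat \<times> nat \<Rightarrow> real"
  assumes r: "r \<ge> 1"
  shows "(\<Sum>w\<in>W_set N - J_set r. W_weight r N w * F w) = (\<Sum>s=2..N. F (s - 1, s, s)) / real N +
    (\<Sum>s=r+1..N. W_geometric N s * (F (s, 1, s) + F (s, s, 1) - F (s - 1, s, s)))"
proof -
  let ?x = "\<lambda>s. if s \<le> r then 0 else W_geometric N s"
  have "(\<Sum>w\<in>W_set N - J_set r. W_weight r N w * F w)
      = (\<Sum>s=r+1..N. W_geometric N s * F (s, 1, s)) + (\<Sum>s=r+1..N. W_geometric N s * F (s, s, 1)) +
        (\<Sum>s=2..N. (1 / real N - ?x s) * F (s - 1, s, s))"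
    unfolding sum_W_set_minus_J_set[OF r]
    by (intro arg_cong2[where f = "(+)"] sum.cong) (auto simp: W_weight_def)
  also have "(\<Sum>s=2..N. (1 / real N - ?x s) * F (s - 1, s, s))
      = (\<Sum>s=2..N. F (s - 1, s, s)) / real N - (\<Sum>s=2..N. ?x s * F (s - 1, s, s))"
    by (simp add: left_diff_distrib sum_subtractf sum_divide_distrib)
  also have "(\<Sum>s=2..N. ?x s * F (s - 1, s, s)) = (\<Sum>s=r+1..N. W_geometric N s * F (s - 1, s, s))"
    using r by (intro sum.mono_neutral_cong_right) auto
  finally show ?thesis by (simp add: sum.distrib sum_subtractf algebra_simps)
qed

lemma sum_W_geometric_telescope:
  assumes "n \<ge> r"
  shows "(\<Sum>s=r+1..n. W_geometric N s * (2 * f s - f (s - 1)))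
    = W_geometric N (n + 1) * f n - W_geometric N (r + 1) * f r"
  using assms
proof (induction n rule: nat_induct_at_least)
  case (Suc n)
  have "W_geometric N (Suc n + 1) = 2 * W_geometric N (Suc n)" by (simp add: W_geometric_def)
  with Suc show ?case by (simp add: algebra_simps)
qed simp

lemma W_geometric_end: "N > 0 \<Longrightarrow> W_geometric N (N + 1) = 1 / real N"
  by (simp add: W_geometric_def)

lemma sum_W_weight_fst:
  assumes r: "r \<ge> 1" and N: "N > r"
  shows "(\<Sum>w\<in>W_set N - J_set r. W_weight r N w * f (fst w))
    = (\<Sum>j=1..N. f j) / real N - W_geometric N (r + 1) * f r"
proof -
  have "(\<Sum>s=2..N. f (s - 1)) = (\<Sum>s=1..N - 1. f s)"
    by (rule sum.reindex_bij_witness[of _ Suc "\<lambda>s. s - 1"]) auto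
  also have "\<dots> = (\<Sum>s=1..N. f s) - f N" using N by (cases N) auto
  finally show ?thesis
    using sum_W_weight[OF r, of N "\<lambda>w. f (fst w)"] sum_W_geometric_telescope[of r N N f] N
    by (simp add: W_geometric_end[of N, simplified] diff_divide_distrib)
qed

lemma sum_W_weight_coordinate_2_or_3:
  fixes F :: "nat \<times> nat \<times> nat \<Rightarrow> real"
  assumes r: "r \<ge> 1" and N: "N > r"
    and F: "\<And>s. F (s, 1, s) + F (s, s, 1) = f 1 + f s" "\<And>s. F (s - 1, s, s) = f s"
  shows "(\<Sum>w\<in>W_set N - J_set r. W_weight r N w * F w)
    = (\<Sum>j=1..N. f j) / real N - W_geometric N (r + 1) * f 1"
proof -
  have "(\<Sum>s=r+1..N. W_geometric N s) = 1 / real N - W_geometric N (r + 1)"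
    using sum_W_geometric_telescope[of r N N "\<lambda>_. 1"] W_geometric_end[of N] N by simp
  then have "(\<Sum>s=r+1..N. W_geometric N s * f 1) = (1 / real N - W_geometric N (r + 1)) * f 1"
    by (simp flip: sum_distrib_right)
  moreover have "(\<Sum>s=2..N. f s) = (\<Sum>s=1..N. f s) - f 1"
    using N r by (subst sum.atLeast_Suc_atMost[of 1 N]) (auto simp: numeral_2_eq_2)
  moreover have "(\<Sum>w\<in>W_set N - J_set r. W_weight r N w * F w)
      = (\<Sum>s=2..N. f s) / real N + (\<Sum>s=r+1..N. W_geometric N s * f 1)"
    unfolding sum_W_weight[OF r] F by simp
  ultimately show ?thesis by (simp only: diff_divide_distrib left_diff_distrib) simp
qed

lemma sum_W_weight_coordinate:
  assumes r: "r \<ge> 1" and N: "N > r" and \<pi>: "\<pi> \<in> {fst, fst \<circ> snd, snd \<circ> snd}"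
  obtains p where "p \<in> {1..N}" and "\<And>f. (\<Sum>w\<in>W_set N - J_set r. W_weight r N w * f (\<pi> w))
    = (\<Sum>j=1..N. f j) / real N - W_geometric N (r + 1) * f p"
proof -
  from \<pi> consider "\<pi> = fst" | "\<pi> = fst \<circ> snd" | "\<pi> = snd \<circ> snd" by blast
  then show thesis
  proof cases
    case 1
    then show thesis using r N sum_W_weight_fst by (intro that[of r]) auto
  next
    case 2
    then show thesis using r N by (intro that[of 1] sum_W_weight_coordinate_2_or_3) auto
  next
    case 3
    then show thesis using r N by (intro that[of 1] sum_W_weight_coordinate_2_or_3) auto
  qed
qed

subsection \<open>Padded tuples\<close>

text \<open>Appending \<open>q\<close> copies of one block does not affect freeness, instability or the size of
  the deviation from the uniform marginal; this gives all degrees from the odd multiples of \<open>3\<close>.\<close>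

definition block_slots :: "nat \<Rightarrow> nat \<Rightarrow> (nat \<times> (nat \<times> nat \<times> nat \<Rightarrow> nat)) list" where
  "block_slots r q = map (\<lambda>l. (l, fst)) [1..<2 * r] @ map (\<lambda>l. (l, fst \<circ> snd)) [1..<2 * r] @
     map (\<lambda>l. (l, snd \<circ> snd)) [1..<2 * r] @ replicate q (1, snd \<circ> snd)"

definition padded_tuple :: "nat \<Rightarrow> nat \<Rightarrow> nat \<Rightarrow> nat \<times> nat \<times> nat \<Rightarrow> nat list" where
  "padded_tuple r m q w = map (\<lambda>(l, \<pi>). sigma r m l (\<pi> w)) (block_slots r q)"

definition Gamma_padded :: "nat \<Rightarrow> nat \<Rightarrow> nat \<Rightarrow> blockvec set" where
  "Gamma_padded r m q = (\<lambda>w. eps_tuple m (padded_tuple r m q w)) ` (W_set (r * m) - J_set r)"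

lemma padded_tuple_eq_append:
  "padded_tuple r m q (i, j, k)
    = sigma_list r m i @ sigma_list r m j @ sigma_list r m k @ replicate q (sigma r m 1 k)"
  by (simp add: padded_tuple_def block_slots_def sigma_list_def)

lemma Gamma_odd_eq_padded: "Gamma_odd m r = Gamma_padded r m 0"
  unfolding Gamma_odd_def Gamma_padded_def by (force simp: padded_tuple_eq_append)

lemma Gamma3_eq_padded:
  assumes "m \<ge> 1"
  shows "Gamma3 m = Gamma_padded 1 m 0"
proof -
  have "sigma_list 1 m j = [j]" if "j \<in> {1..m}" for j
  proof -
    have "(j - 1) mod m = j - 1" using that by (intro mod_less) auto
    then show ?thesis
      using that assms sigma_eq_cyclic_block[of 1 1 m j]
      by (simp add: sigma_list_def cyclic_block_def upt_rec)
  qed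
  then have "eps_tuple m [i, j, k] = eps_tuple m (padded_tuple 1 m 0 (i, j, k))"
    if "(i, j, k) \<in> W_set m" for i j k
    using W_set_range[OF that] by (simp add: padded_tuple_eq_append)
  moreover have "J_set 1 = {}" by (simp add: J_set_def)
  ultimately show ?thesis unfolding Gamma3_def Gamma_padded_def by force
qed

lemma sum_uniform_minus_point_square:
  assumes "k\<^sub>0 \<in> {1..m}"
  shows "(\<Sum>k=1..m. (1 / real m - of_bool (k\<^sub>0 = k))\<^sup>2) = 1 - 1 / real m"
proof -
  have "(\<Sum>k=1..m. of_bool (k\<^sub>0 = k)) = (1::real)" using assms by (simp add: of_bool_def)
  then have "(\<Sum>k=1..m. 1 / (real m)\<^sup>2 + (1 - 2 / real m) * of_bool (k\<^sub>0 = k))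
      = real m * (1 / (real m)\<^sup>2) + (1 - 2 / real m)"
    by (simp add: sum.distrib flip: sum_distrib_left)
  also have "\<dots> = 1 - 1 / real m" using assms by (simp add: power2_eq_square)
  finally have "(\<Sum>k=1..m. 1 / (real m)\<^sup>2 + (1 - 2 / real m) * of_bool (k\<^sub>0 = k)) = 1 - 1 / real m" .
  moreover have "(1 / real m - of_bool (k\<^sub>0 = k))\<^sup>2
      = 1 / (real m)\<^sup>2 + (1 - 2 / real m) * of_bool (k\<^sub>0 = k)" for k
    by (simp add: power2_eq_square algebra_simps)
  ultimately show ?thesis by simp
qed

locale padded_tuples =
  fixes r m q :: nat
  assumes r_ge_1: "r \<ge> 1" and m_ge_2: "m \<ge> 2"
begin

lemma set_block_slots:
  assumes "(l, \<pi>) \<in> set (block_slots r q)"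
  shows "l \<in> {1..<2 * r}" and "\<pi> \<in> {fst, fst \<circ> snd, snd \<circ> snd}"
  using assms r_ge_1 by (auto simp: block_slots_def)

lemma length_padded_tuple: "length (padded_tuple r m q w) = 6 * r - 3 + q"
  using r_ge_1 by (simp add: padded_tuple_def block_slots_def)

lemma set_padded_tuple:
  assumes "w \<in> W_set (r * m) - J_set r"
  shows "set (padded_tuple r m q w) \<subseteq> {1..m}"
proof -
  obtain i j k where "w = (i, j, k)" by (cases w)
  then have "\<pi> w \<ge> 1" if "\<pi> \<in> {fst, fst \<circ> snd, snd \<circ> snd}" for \<pi>
    using W_set_range[of i j k "r * m"] assms that by auto
  then have "sigma r m l (\<pi> w) \<in> {1..m}" if "(l, \<pi>) \<in> set (block_slots r q)" for l \<pi>
    using sigma_range[OF set_block_slots(1)[OF that]] set_block_slots(2)[OF that] m_ge_2 by simp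
  then show ?thesis by (auto simp: padded_tuple_def)
qed

lemma padded_tuples_far:
  assumes "w \<in> W_set (r * m) - J_set r" "w' \<in> W_set (r * m) - J_set r" "w \<noteq> w'"
  shows "2 \<le> hamming_distance (padded_tuple r m q w) (padded_tuple r m q w')"
proof -
  obtain i j k where w: "w = (i, j, k)" by (cases w)
  obtain i' j' k' where w': "w' = (i', j', k')" by (cases w')
  have range: "{i, j, k, i', j', k'} \<subseteq> {1..r * m}"
    using W_set_range[of i j k "r * m"] W_set_range[of i' j' k' "r * m"] assms w w' by auto
  have pos: "0 < hamming_distance (sigma_list r m x) (sigma_list r m y)"
    if "x \<in> {1..r * m}" "y \<in> {1..r * m}" "x \<noteq> y" for x y
    using that inj_on_sigma_list[OF r_ge_1 m_ge_2] by (intro hamming_distance_pos) (auto dest: inj_onD)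
  have "hamming_distance (padded_tuple r m q w) (padded_tuple r m q w')
      \<ge> hamming_distance (sigma_list r m i) (sigma_list r m i') +
        hamming_distance (sigma_list r m j) (sigma_list r m j') +
        hamming_distance (sigma_list r m k) (sigma_list r m k')"
    by (simp add: w w' padded_tuple_eq_append hamming_distance_append)
  moreover have "(i \<noteq> i' \<and> j \<noteq> j') \<or> (i \<noteq> i' \<and> k \<noteq> k') \<or> (j \<noteq> j' \<and> k \<noteq> k')"
    using W_set_two_differences assms w w' by blast
  ultimately show ?thesis
    using pos[of i i'] pos[of j j'] pos[of k k'] range by fastforce
qed

sublocale free_block_tuples "6 * r - 3 + q" m "W_set (r * m) - J_set r" "padded_tuple r m q"
  using r_ge_1 m_ge_2 finite_W_set length_padded_tuple set_padded_tuple padded_tuples_far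
  by unfold_locales auto

lemma padded_functional:
  obtains ys where "length ys = 6 * r - 3 + q" and "(\<Sum>y\<leftarrow>ys. \<Sum>k=1..m. y k) = 0"
    and "\<And>w. w \<in> W_set (r * m) \<Longrightarrow> tuple_eval ys (padded_tuple r m q w) = 1"
proof -
  have "r * m \<ge> 2" using add_one_le_mult[OF r_ge_1 m_ge_2] r_ge_1 by linarith
  then obtain U V :: "nat \<Rightarrow> real"
    where UV: "\<And>i j k. (i, j, k) \<in> W_set (r * m) \<Longrightarrow> U i + V j + V k = 1"
      and UV0: "(\<Sum>j=1..r * m. U j) + 2 * (\<Sum>j=1..r * m. V j) = 0"
    using W_set_functional by blast
  obtain us where us: "length us = 2 * r - 1"
      "\<And>j. j \<in> {1..r * m} \<Longrightarrow> tuple_eval us (sigma_list r m j) = U j"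
    and us0: "real r * (\<Sum>y\<leftarrow>us. \<Sum>k=1..m. y k) = (\<Sum>j=1..r * m. U j)"
    using sigma_list_represents[OF r_ge_1 m_ge_2, of U] by metis
  obtain vs where vs: "length vs = 2 * r - 1"
      "\<And>j. j \<in> {1..r * m} \<Longrightarrow> tuple_eval vs (sigma_list r m j) = V j"
    and vs0: "real r * (\<Sum>y\<leftarrow>vs. \<Sum>k=1..m. y k) = (\<Sum>j=1..r * m. V j)"
    using sigma_list_represents[OF r_ge_1 m_ge_2, of V] by metis
  let ?ys = "us @ vs @ vs @ replicate q (\<lambda>_. 0)"
  have "real r * (\<Sum>y\<leftarrow>?ys. \<Sum>k=1..m. y k)
      = real r * (\<Sum>y\<leftarrow>us. \<Sum>k=1..m. y k) + 2 * (real r * (\<Sum>y\<leftarrow>vs. \<Sum>k=1..m. y k))"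
    by (simp add: sum_list_replicate algebra_simps)
  also have "\<dots> = 0" unfolding us0 vs0 by (rule UV0)
  finally have "(\<Sum>y\<leftarrow>?ys. \<Sum>k=1..m. y k) = 0" using r_ge_1 by simp
  moreover have "tuple_eval ?ys (padded_tuple r m q w) = 1" if "w \<in> W_set (r * m)" for w
  proof -
    obtain i j k where w: "w = (i, j, k)" by (cases w)
    have "tuple_eval (replicate q (\<lambda>_. 0)) (replicate q (sigma r m 1 k)) = 0"
      by (simp add: tuple_eval_def zip_replicate sum_list_replicate)
    then have "tuple_eval ?ys (padded_tuple r m q w) = U i + V j + V k"
      using W_set_range[of i j k "r * m"] that us vs
      by (simp add: w padded_tuple_eq_append tuple_eval_append)
    then show ?thesis using UV that w by simp
  qed
  moreover have "length ?ys = 6 * r - 3 + q" using us(1) vs(1) r_ge_1 by simp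
  ultimately show thesis using that by blast
qed

lemma gap_le_dist_Gamma_padded:
  assumes "SU_invariant_inner ((6 * r - 3 + q) * m) (6 * r - 3 + q) ip"
  shows "gap ((6 * r - 3 + q) * m) (6 * r - 3 + q) ip
      \<le> euclid_dist_0 (convex hull (Gamma_padded r m q))"
proof -
  obtain ys where ys: "length ys = 6 * r - 3 + q" "(\<Sum>y\<leftarrow>ys. \<Sum>k=1..m. y k) = 0"
    and eval: "\<And>w. w \<in> W_set (r * m) \<Longrightarrow> tuple_eval ys (padded_tuple r m q w) = 1"
    using padded_functional by metis
  have "r * m \<ge> 2" using add_one_le_mult[OF r_ge_1 m_ge_2] r_ge_1 by linarith
  then have "(1, 2, 2) \<in> W_set (r * m) - J_set r" unfolding W_set_minus_J_set[OF r_ge_1] by force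
  then have "W_set (r * m) - J_set r \<noteq> {}" by blast
  then show ?thesis
    unfolding Gamma_padded_def by (rule gap_le_euclid_dist_0_hull[OF _ assms ys]) (simp add: eval)
qed

definition defect :: real where
  "defect = W_geometric (r * m) (r + 1)"

definition W_probability :: "nat \<times> nat \<times> nat \<Rightarrow> real" where
  "W_probability w = W_weight r (r * m) w / (1 - defect)"

lemma defect_eq: "defect = 1 / (2 ^ (r * (m - 1)) * real (r * m))"
proof -
  have "r * m = r + r * (m - 1)" using m_ge_2 by (cases m) auto
  then have "(2::real) ^ (r * m) = 2 ^ r * 2 ^ (r * (m - 1))" by (metis power_add)
  then show ?thesis by (simp add: defect_def W_geometric_def)
qed

lemma two_power_mult_gt_1: "2 ^ (r * (m - 1)) * real (r * m) > 1"
proof -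
  have "real (r * m) > 1" using add_one_le_mult[OF r_ge_1 m_ge_2] r_ge_1 by linarith
  then have "1 * 1 < 2 ^ (r * (m - 1)) * real (r * m)" by (intro mult_le_less_imp_less) auto
  then show ?thesis by simp
qed

lemma defect_less_1: "defect < 1"
  unfolding defect_eq using two_power_mult_gt_1 by (simp add: divide_less_eq_1)

lemma sum_W_probability_coordinate:
  assumes "\<pi> \<in> {fst, fst \<circ> snd, snd \<circ> snd}"
  obtains p where "p \<in> {1..r * m}" and "\<And>f. (\<Sum>w\<in>W_set (r * m) - J_set r. W_probability w * f (\<pi> w))
    = ((\<Sum>j=1..r * m. f j) / real (r * m) - defect * f p) / (1 - defect)"
proof -
  have "r * m > r" using add_one_le_mult[OF r_ge_1 m_ge_2] by linarith
  then show thesis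
  proof (rule sum_W_weight_coordinate[OF r_ge_1 _ assms])
    fix p assume p: "p \<in> {1..r * m}"
      and eq: "\<And>f. (\<Sum>w\<in>W_set (r * m) - J_set r. W_weight r (r * m) w * f (\<pi> w))
        = (\<Sum>j=1..r * m. f j) / real (r * m) - W_geometric (r * m) (r + 1) * f p"
    show thesis
      by (rule that[OF p])
         (simp only: W_probability_def defect_def eq times_divide_eq_left flip: sum_divide_distrib)
  qed
qed

lemma W_probability_nonneg: "w \<in> W_set (r * m) \<Longrightarrow> W_probability w \<ge> 0"
  using W_weight_nonneg defect_less_1 by (simp add: W_probability_def)

lemma sum_W_probability: "(\<Sum>w\<in>W_set (r * m) - J_set r. W_probability w) = 1"
proof -
  obtain p where "\<And>f. (\<Sum>w\<in>W_set (r * m) - J_set r. W_probability w * f (fst w))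
      = ((\<Sum>j=1..r * m. f j) / real (r * m) - defect * f p) / (1 - defect)"
    using sum_W_probability_coordinate[of fst] by blast
  from this[of "\<lambda>_. 1"] show ?thesis using r_ge_1 m_ge_2 defect_less_1 by simp
qed

lemma marginal_W_probability:
  assumes b: "b < 6 * r - 3 + q"
  obtains k\<^sub>0 where "k\<^sub>0 \<in> {1..m}" and "\<And>k. k \<in> {1..m} \<Longrightarrow>
    marginal W_probability b k = (1 / real m - defect * of_bool (k\<^sub>0 = k)) / (1 - defect)"
proof -
  obtain l \<pi> where slot: "block_slots r q ! b = (l, \<pi>)" by (cases "block_slots r q ! b")
  have len: "b < length (block_slots r q)" using b length_padded_tuple by (simp add: padded_tuple_def)
  then have "(l, \<pi>) \<in> set (block_slots r q)" using slot nth_mem[OF len] by simp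
  note l = set_block_slots(1)[OF this] and \<pi> = set_block_slots(2)[OF this]
  have nth: "padded_tuple r m q w ! b = sigma r m l (\<pi> w)" for w
    using len slot by (simp add: padded_tuple_def)
  have uniform: "(\<Sum>j=1..r * m. of_bool (sigma r m l j = k)) / real (r * m) = 1 / real m"
    if "k \<in> {1..m}" for k
  proof -
    have "(\<Sum>k'=1..m. of_bool (k' = k)) = (1::real)" using that by (simp add: of_bool_def)
    then show ?thesis using sum_sigma[OF l m_ge_2, of "\<lambda>k'. of_bool (k' = k)"] r_ge_1 by simp
  qed
  show thesis
  proof (rule sum_W_probability_coordinate[OF \<pi>])
    fix p assume p: "p \<in> {1..r * m}"
      and coordinate: "\<And>f. (\<Sum>w\<in>W_set (r * m) - J_set r. W_probability w * f (\<pi> w))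
        = ((\<Sum>j=1..r * m. f j) / real (r * m) - defect * f p) / (1 - defect)"
    have "sigma r m l p \<in> {1..m}" using sigma_range[OF l] m_ge_2 p by simp
    then show thesis
    proof (rule that)
      show "marginal W_probability b k
          = (1 / real m - defect * of_bool (sigma r m l p = k)) / (1 - defect)"
        if "k \<in> {1..m}" for k
        unfolding marginal_def nth coordinate[of "\<lambda>x. of_bool (sigma r m l x = k)"] uniform[OF that] ..
    qed
  qed
qed

lemma deviation_W_probability:
  "deviation W_probability = sqrt (real (6 * r - 3 + q) * (1 - 1 / real m)) * (defect / (1 - defect))"
proof -
  let ?\<rho> = "defect / (1 - defect)"
  have "(\<Sum>k=1..m. (marginal W_probability b k - 1 / real m)\<^sup>2) = ?\<rho>\<^sup>2 * (1 - 1 / real m)"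
    if b: "b < 6 * r - 3 + q" for b
  proof -
    obtain k\<^sub>0 where k\<^sub>0: "k\<^sub>0 \<in> {1..m}" and marginal: "\<And>k. k \<in> {1..m} \<Longrightarrow>
        marginal W_probability b k = (1 / real m - defect * of_bool (k\<^sub>0 = k)) / (1 - defect)"
      using marginal_W_probability[OF b] by metis
    have "marginal W_probability b k - 1 / real m = ?\<rho> * (1 / real m - of_bool (k\<^sub>0 = k))"
      if "k \<in> {1..m}" for k
      unfolding marginal[OF that] using defect_less_1 m_ge_2 by (simp add: field_simps)
    then have "(\<Sum>k=1..m. (marginal W_probability b k - 1 / real m)\<^sup>2)
        = (\<Sum>k=1..m. ?\<rho>\<^sup>2 * (1 / real m - of_bool (k\<^sub>0 = k))\<^sup>2)"
      by (intro sum.cong refl) (simp only: power_mult_distrib)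
    then show ?thesis
      using sum_uniform_minus_point_square[OF k\<^sub>0] by (simp flip: sum_distrib_left)
  qed
  then have "deviation W_probability = sqrt (\<Sum>b<6 * r - 3 + q. ?\<rho>\<^sup>2 * (1 - 1 / real m))"
    unfolding deviation_def by (intro arg_cong[where f = sqrt] sum.cong) auto
  also have "(\<Sum>b<6 * r - 3 + q. ?\<rho>\<^sup>2 * (1 - 1 / real m))
      = real (6 * r - 3 + q) * (1 - 1 / real m) * ?\<rho>\<^sup>2"
    by simp
  also have "sqrt \<dots> = sqrt (real (6 * r - 3 + q) * (1 - 1 / real m)) * \<bar>?\<rho>\<bar>"
    by (simp only: real_sqrt_mult real_sqrt_abs)
  also have "\<bar>?\<rho>\<bar> = ?\<rho>" using W_geometric_nonneg defect_less_1 by (simp add: defect_def)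
  finally show ?thesis .
qed

lemma dist_Gamma_padded_le:
  "euclid_dist_0 (convex hull (Gamma_padded r m q))
    \<le> sqrt (real (6 * r - 3 + q) * (1 - 1 / real m)) / (2 ^ (r * (m - 1)) * real (r * m) - 1)"
proof -
  have "defect / (1 - defect) = 1 / (2 ^ (r * (m - 1)) * real (r * m) - 1)"
  proof -
    have "1 / D / (1 - 1 / D) = 1 / (D - 1)" if "D > 1" for D :: real
      using that by (simp add: divide_simps)
    then show ?thesis unfolding defect_eq using two_power_mult_gt_1 by blast
  qed
  moreover have "euclid_dist_0 (convex hull (Gamma_padded r m q)) \<le> deviation W_probability"
    unfolding Gamma_padded_def
    by (rule euclid_dist_0_hull_le_deviation[OF W_probability_nonneg sum_W_probability]) simp
  ultimately show ?thesis unfolding deviation_W_probability by simp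
qed

lemma dist_Gamma_padded_le_powr:
  assumes s: "sqrt (real (6 * r - 3 + q) * (1 - 1 / real m)) \<le> s"
    and c: "s * 2 ^ (r * (m - 1)) \<le> c * (2 ^ (r * (m - 1)) * real (r * m) - 1)"
  shows "euclid_dist_0 (convex hull (Gamma_padded r m q)) \<le> c * 2 powr (- real r * (real m - 1))"
proof -
  let ?T = "(2::real) ^ (r * (m - 1))"
  have "euclid_dist_0 (convex hull (Gamma_padded r m q)) \<le> s / (?T * real (r * m) - 1)"
    using dist_Gamma_padded_le s two_power_mult_gt_1 by (smt (verit) divide_right_mono)
  also have "\<dots> \<le> c / ?T"
    using c two_power_mult_gt_1 by (simp add: divide_simps)
  also have "?T = 2 powr (real r * (real m - 1))"
    using m_ge_2 by (simp add: of_nat_diff flip: powr_realpow)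
  finally show ?thesis by (simp add: powr_minus_divide)
qed

end

subsection \<open>The gap bounds\<close>

lemma gap_le_dist_Gamma3:
  assumes "m \<ge> 2" "SU_invariant_inner (3 * m) 3 ip"
  shows "gap (3 * m) 3 ip \<le> euclid_dist_0 (convex hull (Gamma3 m))"
proof -
  interpret padded_tuples 1 m 0 using assms by unfold_locales auto
  show ?thesis using gap_le_dist_Gamma_padded[of ip] Gamma3_eq_padded[of m] assms by simp
qed

lemma gap_le_dist_Gamma_odd:
  assumes "m \<ge> 2" "r \<ge> 1" "SU_invariant_inner ((6 * r - 3) * m) (6 * r - 3) ip"
  shows "gap ((6 * r - 3) * m) (6 * r - 3) ip \<le> euclid_dist_0 (convex hull (Gamma_odd m r))"
proof -
  interpret padded_tuples r m 0 using assms by unfold_locales auto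
  show ?thesis using gap_le_dist_Gamma_padded[of ip] assms(3) by (simp add: Gamma_odd_eq_padded)
qed

lemma dist_Gamma3_le:
  assumes m: "m \<ge> 3"
  shows "euclid_dist_0 (convex hull (Gamma3 m)) \<le> 2 powr (- real m + 1)"
proof -
  interpret padded_tuples 1 m 0 using m by unfold_locales auto
  have "sqrt (3 * (1 - 1 / real m)) \<le> 2"
  proof (rule real_le_lsqrt)
    have "3 * (1 - 1 / real m) \<le> 3 * 1" by (intro mult_left_mono) auto
    also have "\<dots> \<le> 2\<^sup>2" by simp
    finally show "3 * (1 - 1 / real m) \<le> 2\<^sup>2" .
  qed simp
  moreover have "2 * 2 ^ (m - 1) \<le> 2 ^ (m - 1) * real m - 1"
  proof -
    have "2 ^ (m - 1) * 3 \<le> 2 ^ (m - 1) * real m" using m by (intro mult_left_mono) auto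
    moreover have "(1::real) \<le> 2 ^ (m - 1)" by simp
    ultimately show ?thesis by linarith
  qed
  ultimately show ?thesis
    using dist_Gamma_padded_le_powr[of 2 1] m by (simp add: Gamma3_eq_padded)
qed

lemma dist_Gamma_odd_le:
  assumes m: "m \<ge> 3" and r: "r \<ge> 1"
  shows "euclid_dist_0 (convex hull (Gamma_odd m r)) \<le> 2 powr (- real r * (real m - 1) + 1)"
proof -
  interpret padded_tuples r m 0 using m r by unfold_locales auto
  have "sqrt (real (6 * r - 3) * (1 - 1 / real m)) \<le> 3 * real r"
  proof (rule real_le_lsqrt)
    have "real (6 * r - 3) * (1 - 1 / real m) \<le> real (6 * r - 3) * 1" by (intro mult_left_mono) auto
    also have "\<dots> \<le> 6 * (real r * 1)" by simp
    also have "\<dots> \<le> 9 * (real r * real r)" using r by (intro mult_mono) auto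
    finally show "real (6 * r - 3) * (1 - 1 / real m) \<le> (3 * real r)\<^sup>2" by (simp add: power2_eq_square)
  qed auto
  moreover have "3 * real r * 2 ^ (r * (m - 1)) \<le> 2 * (2 ^ (r * (m - 1)) * real (r * m) - 1)"
  proof -
    have "1 * 1 \<le> 2 ^ (r * (m - 1)) * real r" using r by (intro mult_mono) auto
    moreover have "2 ^ (r * (m - 1)) * real r * 3 \<le> 2 ^ (r * (m - 1)) * real r * real m"
      using m by (intro mult_left_mono) auto
    ultimately show ?thesis by (simp add: algebra_simps)
  qed
  ultimately have "euclid_dist_0 (convex hull (Gamma_odd m r)) \<le> 2 * 2 powr (- real r * (real m - 1))"
    using dist_Gamma_padded_le_powr[of "3 * real r" 2] by (simp add: Gamma_odd_eq_padded)
  then show ?thesis unfolding powr_add by simp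
qed

lemma (in padded_tuples) dist_Gamma_padded_le_four_thirds:
  assumes "q \<le> 5"
  shows "euclid_dist_0 (convex hull (Gamma_padded r m q)) \<le> 4 / 3 * 2 powr (- real r * (real m - 1))"
proof (rule dist_Gamma_padded_le_powr)
  have rm: "2 \<le> real (r * m)" using add_one_le_mult[OF r_ge_1 m_ge_2] r_ge_1 by linarith
  show "sqrt (real (6 * r - 3 + q) * (1 - 1 / real m)) \<le> real (r * m)"
  proof (rule real_le_lsqrt)
    have "0 \<le> (real m - 2)\<^sup>2" by simp
    then have "1 - 1 / real m \<le> real m / 4" using m_ge_2 by (simp add: power2_eq_square field_simps)
    moreover have "real (6 * r - 3 + q) \<le> 8 * real r" using r_ge_1 assms by linarith
    ultimately have "real (6 * r - 3 + q) * (1 - 1 / real m) \<le> 8 * real r * (real m / 4)"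
      using m_ge_2 by (intro mult_mono) auto
    also have "\<dots> = 2 * real (r * m)" by simp
    also have "\<dots> \<le> real (r * m) * real (r * m)" using rm by (intro mult_right_mono) auto
    finally show "real (6 * r - 3 + q) * (1 - 1 / real m) \<le> (real (r * m))\<^sup>2"
      by (simp add: power2_eq_square)
  qed simp
  have "r * (m - 1) \<ge> 1" using r_ge_1 m_ge_2 by simp
  then have "(2::real) ^ 1 \<le> 2 ^ (r * (m - 1))" by (intro power_increasing) auto
  then have "2 * 2 \<le> 2 ^ (r * (m - 1)) * real (r * m)" using rm by (intro mult_mono) auto
  then show "real (r * m) * 2 ^ (r * (m - 1)) \<le> 4 / 3 * (2 ^ (r * (m - 1)) * real (r * m) - 1)"
    by (simp add: algebra_simps)
qed

lemma gap_le_exponential: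
  assumes d: "d \<ge> 3" and m: "m \<ge> 2" and inv: "SU_invariant_inner (d * m) d ip"
  shows "gap (d * m) d ip \<le> 2 powr (- (1 / 32) * real d * real m)"
proof -
  define r q where "r = (d + 3) div 6" and "q = d - (6 * r - 3)"
  have r: "r \<ge> 1" and dq: "d = 6 * r - 3 + q" and q: "q \<le> 5"
    using d unfolding r_def q_def by auto
  interpret padded_tuples r m q using r m by unfold_locales
  define K where "K = real r * (real m - 1)"
  have K: "K \<ge> 1" unfolding K_def using r m mult_mono[of 1 "real r" 1 "real m - 1"] by simp
  have "gap (d * m) d ip \<le> euclid_dist_0 (convex hull (Gamma_padded r m q))"
    using gap_le_dist_Gamma_padded inv unfolding dq[symmetric] by blast
  also have "\<dots> \<le> 4 / 3 * 2 powr (- K)"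
    using dist_Gamma_padded_le_four_thirds[OF q] by (simp add: K_def)
  also have "\<dots> \<le> 2 powr (1 / 2) * 2 powr (- K)"
  proof (rule mult_right_mono)
    have "4 / 3 \<le> sqrt 2" by (rule real_le_rsqrt) (simp add: power2_eq_square)
    then show "4 / 3 \<le> 2 powr (1 / 2 :: real)" by (simp add: powr_half_sqrt)
  qed simp
  also have "\<dots> = 2 powr (1 / 2 - K)" by (simp flip: powr_add)
  also have "\<dots> \<le> 2 powr (- (1 / 32) * real d * real m)"
  proof (rule powr_mono)
    have "real d \<le> 8 * real r" using dq q r by linarith
    then have "real d * real m \<le> (8 * real r) * (2 * (real m - 1))"
      using m by (intro mult_mono) auto
    also have "\<dots> = 16 * K" by (simp add: K_def)
    finally show "1 / 2 - K \<le> - (1 / 32) * real d * real m" using K by simp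
  qed simp
  finally show ?thesis .
qed

theorem theorem4p17:
  shows "(\<exists>C::real. C > 0 \<and>
      (\<forall>d m n :: nat. \<forall>ip. d \<ge> 3 \<and> m \<ge> 2 \<and> n = d * m \<and> SU_invariant_inner n d ip \<longrightarrow>
        gap n d ip \<le> 2 powr (- C * real d * real m) \<and>
        2 powr (- C * real d * real m) = 2 powr (- C * real n)))
    \<and> (\<forall>d m n :: nat. d = 3 \<and> m \<ge> 3 \<and> n = d * m \<longrightarrow>
        (\<forall>ip. SU_invariant_inner n d ip \<longrightarrow>
           gap n d ip \<le> euclid_dist_0 (convex hull (Gamma3 m))) \<and>
        euclid_dist_0 (convex hull (Gamma3 m)) \<le> 2 powr (- real m + 1) \<and>
        2 powr (- real m + 1) = 2 powr (- real n / 3 + 1))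
    \<and> (\<forall>d m n r :: nat. m \<ge> 3 \<and> r \<ge> 2 \<and> d = 6 * r - 3 \<and> n = d * m \<longrightarrow>
        (\<forall>ip. SU_invariant_inner n d ip \<longrightarrow>
           gap n d ip \<le> euclid_dist_0 (convex hull (Gamma_odd m r))) \<and>
        euclid_dist_0 (convex hull (Gamma_odd m r)) \<le> 2 powr (- real r * (real m - 1) + 1) \<and>
        2 powr (- real r * (real m - 1) + 1) = 2 powr (- ((real d + 3) * (real m - 1) / 6) + 1))"
    (is "?exponential \<and> ?degree_three \<and> ?odd_degree")
proof (intro conjI)
  show ?exponential
    by (rule exI[of _ "1 / 32"]) (use gap_le_exponential in auto)
  show ?degree_three
    using gap_le_dist_Gamma3 dist_Gamma3_le by simp
  show ?odd_degree
  proof (intro allI impI conjI)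
    fix d m n r :: nat
    assume params: "m \<ge> 3 \<and> r \<ge> 2 \<and> d = 6 * r - 3 \<and> n = d * m"
    show "gap n d ip \<le> euclid_dist_0 (convex hull (Gamma_odd m r))" if "SU_invariant_inner n d ip" for ip
      using params that gap_le_dist_Gamma_odd[of m r ip] by simp
    show "euclid_dist_0 (convex hull (Gamma_odd m r)) \<le> 2 powr (- real r * (real m - 1) + 1)"
      using params by (intro dist_Gamma_odd_le) auto
    have "real d + 3 = 6 * real r" using params by simp
    then show "2 powr (- real r * (real m - 1) + 1) = 2 powr (- ((real d + 3) * (real m - 1) / 6) + 1)"
      by simp
  qed
qed

end
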